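(* Let $I_T\subset K[x_1,\dots,x_s]$ be a simple toric ideal of codimension $2$, and let $\widetilde{\mathbf t}_1,\dots,\widetilde{\mathbf t}_s\in\mathbb Z^2$ be the reduced Gale transform of $T$. Then the strongly robustness complex $\Delta_T$ is a simplicial subcomplex of the simplex whose vertices are those $i\in\{1,\dots,s\}$ such that $\widetilde{\mathbf t}_i$ is not a vertex of the centrally symmetric polygon $$P=\operatorname{conv}\left(\{\widetilde{\mathbf t}_i,-\widetilde{\mathbf t}_i\mid i\in\{1,\dots,s\}\}\right).$$
   Context: $K$ is a field. For an integer matrix $M$ with $n$ columns, $\operatorname{Ker}_{\mathbb Z}(M)=\{\mathbf u\in\mathbb Z^n: M\mathbf u=0\}$, and the toric ideal $I_M\subset K[x_1,\dots,x_n]$ is generated by the binomials $x^{\mathbf u^+}-x^{\mathbf u^-}$, $\mathbf u\in\operatorname{Ker}_{\mathbb Z}(M)$, where $\mathbf u=\mathbf u^+-\mathbf u^-$ with $\mathbf u^\pm\in\mathbb N^n$ of disjoint supports. Standing assumption: all toric ideals considered (in particular $I_T$) come from matrices $M$ with $\operatorname{Ker}_{\mathbb Z}(M)\cap\mathbb N^n=\{\mathbf 0\}$ (positively graded). The codimension of $I_M$ is the rank of $\operatorname{Ker}_{\mathbb Z}(M)$. Reduced Gale transform. If $T$ has $s$ columns and rank $s-2$, its Gale transform is an $s\times2$ integer matrix whose columns form a basis of $\operatorname{Ker}_{\mathbb Z}(T)$, with rows $\mathbf t_i=(t_{i1},t_{i2})$; the reduced Gale transform consists of $\widetilde{\mathbf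 t}_i=\gcd(t_{i1},t_{i2})^{-1}(-t_{i2},t_{i1})$ if $\mathbf t_i\neq(0,0)$ and $\widetilde{\mathbf t}_i=(0,0)$ otherwise. Bouquets. Let $A=[\mathbf a_1,\dots,\mathbf a_n]\in\mathbb Z^{m\times n}$ have rank $r$. Its Gale transform is an $n\times(n-r)$ integer matrix whose columns form a basis of the lattice $\operatorname{Ker}_{\mathbb Z}(A)$; its rows are $\mathbf b_1,\dots,\mathbf b_n$. The vector $\mathbf a_i$ is free if $\mathbf b_i=\mathbf 0$. The bouquet graph has vertices $\mathbf a_1,\dots,\mathbf a_n$ and edges $\{\mathbf a_i,\mathbf a_j\}$ whenever $\mathbf b_i$ is a rational multiple of $\mathbf b_j$ and vice versa; its connected components are the bouquets. The free vectors, if any, form one bouquet, the free bouquet. A non-free bouquet is mixed if it contains an edge $\{\mathbf a_i,\mathbf a_j\}$ with $\mathbf b_i=\lambda\mathbf b_j$ for some $\lambda<0$; otherwise (isolated vertex, or $\lambda>0$ for all its edges) it is non-mixed. List the bouquets as $B_1,\dots,B_s$ and reorder the columns as $\mathbf a_{11},\dots,\mathbf a_{1k_1},\dots,\mathbf a_{s1},\dots,\mathbf a_{sk_s}$, with $\mathbf a_{i1},\dots,\mathbf a_{ik_i}$ the elements of $B_i$. Define $\mathbf c_{B_i}\in\mathbb Z^n$, supported on the positions $i1,\dots,ik_i$ with coordinates $c_{i1},\dots,c_{ik_i}$ there: if $B_i$ is free, $\mathbf c_{B_i}$ is any vector with support exactly $\{i1,\dots,ik_i\}$ and $c_{i1}>0$;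 if $B_i$ is non-free, choose an index $l$ with $(\mathbf b_{ij})_l\neq0$ for all $j$, put $g_l=\gcd((\mathbf b_{i1})_l,\dots,(\mathbf b_{ik_i})_l)$ and $c_{ij}=\varepsilon_{i1}(\mathbf b_{ij})_l/g_l$, where $\varepsilon_{i1}$ is the sign of $(\mathbf b_{i1})_l$. Let $\mathbf a_{B_i}=\sum_j c_{ij}\mathbf a_{ij}$ and $A_B=[\mathbf a_{B_1},\dots,\mathbf a_{B_s}]$; the bouquet ideal of $I_A$ is $I_{A_B}\subset K[x_1,\dots,x_s]$. The map $D(\mathbf u)=\sum_{i=1}^s u_i\mathbf c_{B_i}$ is an isomorphism $\operatorname{Ker}_{\mathbb Z}(A_B)\to\operatorname{Ker}_{\mathbb Z}(A)$ (known fact). A toric ideal is simple if every bouquet is a singleton. Given a simple toric ideal $I_T\subset K[x_1,\dots,x_s]$ and $\omega\subseteq[s]=\{1,\dots,s\}$, a toric ideal $I_A$ is $T_\omega$-robust if its bouquet ideal is $I_T$ (so $\operatorname{Ker}_{\mathbb Z}(A_B)=\operatorname{Ker}_{\mathbb Z}(T)$, the bouquet $B_i$ corresponding to $x_i$) and $\omega=\{i: B_i\text{ is non-mixed}\}$. A binomial $x^{\mathbf u^+}-x^{\mathbf u^-}\in I_M$ is primitive if there is no other binomial $x^{\mathbf v^+}-x^{\mathbf v^-}\in I_M$ with $x^{\mathbf v^+}\mid x^{\mathbf u^+}$ and $x^{\mathbf v^-}\mid x^{\mathbf u^-}$ (here $\mathbf u,\mathbf v\neq\mathbf 0$). The Graver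 basis $\operatorname{Gr}(I_M)$ is the set of primitive binomials, and $\operatorname{Gr}(M)$ is the set of corresponding vectors $\mathbf u$. The set $S(M)$ of indispensable elements is the set of $\mathbf u\in\operatorname{Ker}_{\mathbb Z}(M)$ such that $x^{\mathbf u^+}-x^{\mathbf u^-}$ belongs, up to sign, to every minimal system of binomial generators of $I_M$. Opposite vectors (binomials) are identified in these sets. For $\omega\subseteq[s]$, $S_\omega(T)=\{\mathbf u\in\operatorname{Gr}(T): D(\mathbf u)\in S(A)\}$, where $I_A$ is any $T_\omega$-robust toric ideal (this is independent of the choice of $I_A$). The strongly robustness complex of $T$ is $\Delta_T=\{\omega\subseteq[s]: S_\omega(T)=\operatorname{Gr}(T)\}$. *)

theory Defs
  imports
    "HOL-Analysis.Polytope"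
    "HOL-Library.Poly_Mapping"
    "Jordan_Normal_Form.Matrix_Kernel"
begin

unbundle no vec_syntax

text \<open>Indices of columns, variables and bouquets start at 0, so the set \<open>[s]\<close> becomes \<open>{..<s}\<close>.\<close>

section \<open>Polynomial rings in finitely many variables\<close>

text \<open>Finitely supported exponents \<open>nat \<Rightarrow>\<^sub>0 nat\<close> give the polynomial ring in countably many variables;
  \<open>K[x\<^sub>1, \<dots>, x\<^sub>n]\<close> is its subring \<open>polys n\<close> of polynomials in the variables with index below \<open>n\<close>.\<close>

type_synonym 'k mpoly = "(nat \<Rightarrow>\<^sub>0 nat) \<Rightarrow>\<^sub>0 'k"

definition polys :: "nat \<Rightarrow> 'k::field mpoly set" where
  "polys n = {p. \<forall>m \<in> Poly_Mapping.keys p. Poly_Mapping.keys m \<subseteq> {..<n}}"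

definition ideal_generated :: "nat \<Rightarrow> 'k::field mpoly set \<Rightarrow> 'k mpoly set" where
  "ideal_generated n B =
     {\<Sum>b\<in>F. q b * b | F q. finite F \<and> F \<subseteq> B \<and> (\<forall>b\<in>F. q b \<in> polys n)}"

definition monomial :: "nat vec \<Rightarrow> 'k::field mpoly" where
  "monomial a = Poly_Mapping.single (\<Sum>i<dim_vec a. Poly_Mapping.single i (a $ i)) 1"

definition binomials :: "nat \<Rightarrow> 'k::field mpoly set" where
  "binomials n =
     {monomial a - monomial b | a b. a \<in> carrier_vec n \<and> b \<in> carrier_vec n \<and> a \<noteq> b}"

section \<open>Toric ideals\<close>

text \<open>\<open>Ker\<^sub>\<int>(M)\<close> is \<open>mat_kernel M\<close> for an integer matrix \<open>M\<close>.\<close>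

definition pos_part :: "int vec \<Rightarrow> nat vec" where
  "pos_part u = map_vec nat u"

definition neg_part :: "int vec \<Rightarrow> nat vec" where
  "neg_part u = map_vec nat (- u)"

definition binomial_of :: "int vec \<Rightarrow> 'k::field mpoly" where
  "binomial_of u = monomial (pos_part u) - monomial (neg_part u)"

definition toric_ideal :: "int mat \<Rightarrow> 'k::field mpoly set" where
  "toric_ideal M = ideal_generated (dim_col M) (binomial_of ` mat_kernel M)"

definition positively_graded :: "int mat \<Rightarrow> bool" where
  "positively_graded M \<longleftrightarrow>
     {u \<in> mat_kernel M. \<forall>i<dim_col M. u $ i \<ge> 0} = {0\<^sub>v (dim_col M)}"

text \<open>The columns of \<open>G\<close> form a basis of the lattice \<open>Ker\<^sub>\<int>(M)\<close>: every element of the lattice is an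
  integer combination of them with unique coefficients.\<close>

definition gale_transform :: "int mat \<Rightarrow> int mat \<Rightarrow> bool" where
  "gale_transform M G \<longleftrightarrow> dim_row G = dim_col M \<and>
     bij_betw (\<lambda>x. G *\<^sub>v x) (carrier_vec (dim_col G)) (mat_kernel M)"

text \<open>The rank of the free abelian group \<open>Ker\<^sub>\<int>(M)\<close>, as the number of elements of a basis.\<close>

definition codimension :: "int mat \<Rightarrow> nat" where
  "codimension M = (THE k. \<exists>G. gale_transform M G \<and> dim_col G = k)"

text \<open>Sets of vectors that are considered up to sign are represented by sets closed under negation.\<close>

definition graver :: "'k::field itself \<Rightarrow> int mat \<Rightarrow> int vec set" where
  "graver K M = {u \<in> carrier_vec (dim_col M). u \<noteq> 0\<^sub>v (dim_col M) \<and>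
     (binomial_of u :: 'k mpoly) \<in> toric_ideal M \<and>
     \<not> (\<exists>v \<in> carrier_vec (dim_col M). v \<noteq> 0\<^sub>v (dim_col M) \<and> v \<noteq> u \<and>
          (binomial_of v :: 'k mpoly) \<in> toric_ideal M \<and>
          (monomial (pos_part v) :: 'k mpoly) dvd monomial (pos_part u) \<and>
          (monomial (neg_part v) :: 'k mpoly) dvd monomial (neg_part u))}"

definition minimal_binomial_generators :: "int mat \<Rightarrow> 'k::field mpoly set \<Rightarrow> bool" where
  "minimal_binomial_generators M B \<longleftrightarrow> B \<subseteq> binomials (dim_col M) \<and>
     ideal_generated (dim_col M) B = toric_ideal M \<and>
     (\<forall>B'. B' \<subset> B \<longrightarrow> ideal_generated (dim_col M) B' \<noteq> toric_ideal M)"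

definition indispensable :: "'k::field itself \<Rightarrow> int mat \<Rightarrow> int vec set" where
  "indispensable K M = {u \<in> mat_kernel M.
     \<forall>B :: 'k mpoly set. minimal_binomial_generators M B \<longrightarrow>
       binomial_of u \<in> B \<or> - binomial_of u \<in> B}"

section \<open>Bouquets\<close>

text \<open>\<open>G\<close> is a Gale transform with rows \<open>b\<^sub>i\<close>; the vertex \<open>a\<^sub>i\<close> of the bouquet graph is represented by
  its column index \<open>i\<close>.\<close>

abbreviation (input) rat_row :: "int mat \<Rightarrow> nat \<Rightarrow> rat vec" where
  "rat_row G i \<equiv> map_vec rat_of_int (row G i)"

definition bouquet_edges :: "int mat \<Rightarrow> (nat \<times> nat) set" where
  "bouquet_edges G = {(i, j). i < dim_row G \<and> j < dim_row G \<and> i \<noteq> j \<and>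
     (\<exists>q. rat_row G i = q \<cdot>\<^sub>v rat_row G j) \<and> (\<exists>q. rat_row G j = q \<cdot>\<^sub>v rat_row G i)}"

definition bouquets :: "int mat \<Rightarrow> nat set set" where
  "bouquets G = {(bouquet_edges G)\<^sup>* `` {i} | i. i < dim_row G}"

definition free_bouquet :: "int mat \<Rightarrow> nat set \<Rightarrow> bool" where
  "free_bouquet G B \<longleftrightarrow> (\<forall>i\<in>B. row G i = 0\<^sub>v (dim_col G))"

definition mixed_bouquet :: "int mat \<Rightarrow> nat set \<Rightarrow> bool" where
  "mixed_bouquet G B \<longleftrightarrow> \<not> free_bouquet G B \<and>
     (\<exists>i\<in>B. \<exists>j\<in>B. (i, j) \<in> bouquet_edges G \<and> (\<exists>q<0. rat_row G i = q \<cdot>\<^sub>v rat_row G j))"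

text \<open>The free bouquet is neither mixed nor non-mixed.\<close>

definition non_mixed_bouquet :: "int mat \<Rightarrow> nat set \<Rightarrow> bool" where
  "non_mixed_bouquet G B \<longleftrightarrow> \<not> free_bouquet G B \<and> \<not> mixed_bouquet G B"

definition simple_toric :: "int mat \<Rightarrow> bool" where
  "simple_toric M \<longleftrightarrow> (\<exists>G. gale_transform M G \<and> (\<forall>B\<in>bouquets G. is_singleton B))"

text \<open>\<open>bs\<close> lists the elements of a bouquet; its head is the distinguished element \<open>a\<^sub>i\<^sub>1\<close>, which fixes
  the sign of the vector \<open>c\<^sub>B\<close>. The columns of the matrix are not reordered: the coordinates of
  \<open>c\<close> belonging to the bouquet are those with index in \<open>set bs\<close>.\<close>

definition bouquet_vector :: "int mat \<Rightarrow> nat list \<Rightarrow> int vec \<Rightarrow> bool" where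
  "bouquet_vector G bs c \<longleftrightarrow> c \<in> carrier_vec (dim_row G) \<and>
     (\<forall>k<dim_row G. k \<notin> set bs \<longrightarrow> c $ k = 0) \<and>
     (if free_bouquet G (set bs)
      then (\<forall>k\<in>set bs. c $ k \<noteq> 0) \<and> c $ hd bs > 0
      else (\<exists>l<dim_col G. (\<forall>k\<in>set bs. G $$ (k, l) \<noteq> 0) \<and>
             (\<forall>k\<in>set bs. c $ k =
                sgn (G $$ (hd bs, l)) * (G $$ (k, l) div Gcd ((\<lambda>j. G $$ (j, l)) ` set bs)))))"

text \<open>\<open>Bs\<close> lists the bouquets of \<open>A\<close>, and the columns of \<open>C\<close> are the corresponding vectors
  \<open>c\<^sub>B\<close>. Hence \<open>A\<^sub>B = A * C\<close> and \<open>D(u) = C *\<^sub>v u\<close>.\<close>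

definition bouquet_decomposition ::
    "int mat \<Rightarrow> int mat \<Rightarrow> nat list list \<Rightarrow> int mat \<Rightarrow> bool" where
  "bouquet_decomposition A G Bs C \<longleftrightarrow> gale_transform A G \<and>
     distinct (concat Bs) \<and> set ` set Bs = bouquets G \<and>
     C \<in> carrier_mat (dim_col A) (length Bs) \<and>
     (\<forall>i<length Bs. bouquet_vector G (Bs ! i) (col C i))"

section \<open>The strongly robustness complex\<close>

definition robust_over ::
    "'k::field itself \<Rightarrow> int mat \<Rightarrow> nat set \<Rightarrow> int mat \<Rightarrow> int mat \<Rightarrow> nat list list \<Rightarrow> int mat \<Rightarrow> bool" where
  "robust_over K T \<omega> A G Bs C \<longleftrightarrow>
     positively_graded A \<and> bouquet_decomposition A G Bs C \<and> length Bs = dim_col T \<and>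
     (toric_ideal (A * C) :: 'k mpoly set) = toric_ideal T \<and>
     \<omega> = {i. i < dim_col T \<and> non_mixed_bouquet G (set (Bs ! i))}"

text \<open>The condition \<open>C *\<^sub>v u \<in> indispensable K A\<close> is independent of the choice of the \<open>T\<^sub>\<omega>\<close>-robust
  ideal \<open>I\<^sub>A\<close>, so an existential quantifier stands for the choice of one such ideal. If \<open>\<omega>\<close> contains the
  index of the free bouquet of \<open>T\<close>, there is no \<open>T\<^sub>\<omega>\<close>-robust ideal and \<open>S_omega K T \<omega>\<close> is empty.\<close>

definition S_omega :: "'k::field itself \<Rightarrow> int mat \<Rightarrow> nat set \<Rightarrow> int vec set" where
  "S_omega K T \<omega> = {u \<in> graver K T.
     \<exists>A G Bs C. robust_over K T \<omega> A G Bs C \<and> C *\<^sub>v u \<in> indispensable K A}"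

definition robustness_complex :: "'k::field itself \<Rightarrow> int mat \<Rightarrow> nat set set" where
  "robustness_complex K T = {\<omega>. \<omega> \<subseteq> {..<dim_col T} \<and> S_omega K T \<omega> = graver K T}"

definition abstract_simplicial_complex :: "'a set set \<Rightarrow> bool" where
  "abstract_simplicial_complex \<Delta> \<longleftrightarrow>
     {} \<in> \<Delta> \<and> (\<forall>\<sigma>\<in>\<Delta>. finite \<sigma> \<and> (\<forall>\<tau>. \<tau> \<subseteq> \<sigma> \<longrightarrow> \<tau> \<in> \<Delta>))"

section \<open>The reduced Gale transform\<close>

definition reduced_gale :: "int mat \<Rightarrow> nat \<Rightarrow> int \<times> int" where
  "reduced_gale G i =
     (let a = G $$ (i, 0); b = G $$ (i, 1); g = gcd a b
      in if a = 0 \<and> b = 0 then (0, 0) else (- (b div g), a div g))"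

definition reduced_gale_point :: "int mat \<Rightarrow> nat \<Rightarrow> real \<times> real" where
  "reduced_gale_point G i = map_prod of_int of_int (reduced_gale G i)"

definition gale_polygon :: "int mat \<Rightarrow> (real \<times> real) set" where
  "gale_polygon G =
     convex hull (\<Union>i<dim_row G. {reduced_gale_point G i, - reduced_gale_point G i})"

end

theory Submission
  imports Defs
begin

text \<open>Everything is reduced to a statement about splittings \<open>u = v + w\<close> in the lattice \<open>Ker\<^sub>\<int>(T)\<close>, which in
  codimension two becomes plane geometry.

  For a positively graded toric ideal, \<open>u\<close> is indispensable exactly if it has no decomposition into
  non-zero lattice elements that is semiconformal, that is, without a coordinate where \<open>v\<close> is positive and \<open>w\<close> is
  negative (\<open>splits_imp_not_indispensable\<close>, \<open>not_splits_imp_indispensable\<close>). Apply this to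
  the element \<open>D(u)\<close> of a \<open>T\<^sub>\<omega>\<close>-robust ideal. On a non-mixed bouquet all coordinates of \<open>D(u)\<close> are non-negative
  multiples of \<open>u\<^sub>i\<close>, so semiconformality is inherited from the coordinate \<open>i\<close>; on a mixed bouquet both signs
  occur and the condition says that \<open>v\<^sub>i\<close> and \<open>w\<^sub>i\<close> do not have opposite signs. So, for a
  Graver element \<open>u\<close>, indispensability of \<open>D(u)\<close> means that \<open>u\<close> has no splitting that is semiconformal on \<open>\<omega>\<close>
  and conformal elsewhere (\<open>S_omega_eq\<close>); the robust ideals needed for this come from doubling all
  variables, with equal signs on \<open>\<omega>\<close> and opposite signs elsewhere. A smaller \<open>\<omega>\<close> admits fewer splittings,
  and \<open>\<omega> = {}\<close> none at all, as Graver elements have no conformal splitting. Hence the complex is simplicial.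

  In codimension two the elements of \<open>Ker\<^sub>\<int>(T)\<close> are the vectors of values \<open>\<langle>t\<^sub>k, z\<rangle>\<close> with \<open>z \<in> \<int>\<^sup>2\<close>, and the
  reduced vector \<open>e\<close> of \<open>t\<^sub>i\<close> is a primitive point of the line \<open>\<langle>t\<^sub>i, z\<rangle> = 0\<close>. It gives a Graver element. If \<open>e\<close> is a
  vertex of the polygon, consider the two lines of lattice points next to \<open>\<int>\<cdot>e\<close>, and on each of them the first
  point on the same side as \<open>e\<close> of all lines \<open>\<langle>t\<^sub>k, z\<rangle> = 0\<close>. Both points lie in the polygon
  (\<open>first_point_of_adjacent_line\<close>) and their sum is a multiple of \<open>e\<close>. Since \<open>e\<close> is a vertex and the grading is
  positive, the sum is \<open>e\<close> itself, which is a splitting that is conformal except at \<open>i\<close>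
  (\<open>extreme_point_splits\<close>). So no face of the complex contains \<open>i\<close>.\<close>

section \<open>Polynomials and ideals\<close>

definition exponent :: "nat vec \<Rightarrow> (nat \<Rightarrow>\<^sub>0 nat)" where
  "exponent a = (\<Sum>i<dim_vec a. Poly_Mapping.single i (a $ i))"

lemma monomial_eq_single: "monomial a = Poly_Mapping.single (exponent a) 1"
  by (simp add: monomial_def exponent_def)

lemma lookup_exponent:
  "Poly_Mapping.lookup (exponent a) j = (if j < dim_vec a then a $ j else 0)"
proof -
  have "Poly_Mapping.lookup (exponent a) j = (\<Sum>i<dim_vec a. if i = j then a $ i else 0)"
    unfolding exponent_def lookup_sum
    by (intro sum.cong) (auto simp: lookup_single when_def)
  then show ?thesis by simp
qed

lemma keys_exponent_subset: "Poly_Mapping.keys (exponent a) \<subseteq> {..<dim_vec a}"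
  by (auto simp: in_keys_iff lookup_exponent split: if_splits)

lemma exponent_inject:
  assumes "a \<in> carrier_vec n" "b \<in> carrier_vec n"
  shows "exponent a = exponent b \<longleftrightarrow> a = b"
proof
  assume eq: "exponent a = exponent b"
  show "a = b"
  proof (intro eq_vecI)
    fix i assume "i < dim_vec b"
    moreover have "Poly_Mapping.lookup (exponent a) i = Poly_Mapping.lookup (exponent b) i"
      by (simp add: eq)
    ultimately show "a $ i = b $ i" using assms by (simp add: lookup_exponent)
  qed (use assms in auto)
qed simp

lemma exponent_add:
  assumes "a \<in> carrier_vec n" "b \<in> carrier_vec n"
  shows "exponent (a + b) = exponent a + exponent b"
  using assms by (intro poly_mapping_eqI) (auto simp: lookup_exponent lookup_add)

lemma monomial_mult:
  assumes "a \<in> carrier_vec n" "b \<in> carrier_vec n"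
  shows "monomial a * monomial b = (monomial (a + b) :: 'k::field mpoly)"
  using assms by (simp add: monomial_eq_single mult_single exponent_add)

lemma monomial_dvd_iff:
  assumes "a \<in> carrier_vec n" "b \<in> carrier_vec n"
  shows "(monomial a :: 'k::field mpoly) dvd monomial b \<longleftrightarrow> (\<forall>i<n. a $ i \<le> b $ i)"
proof
  assume "(monomial a :: 'k mpoly) dvd monomial b"
  then obtain q where q: "(monomial b :: 'k mpoly) = monomial a * q" by (auto elim: dvdE)
  have "exponent b \<in> Poly_Mapping.keys (monomial b :: 'k mpoly)"
    by (simp add: monomial_eq_single)
  then have "exponent b \<in> {x + y | x y. x \<in> Poly_Mapping.keys (monomial a :: 'k mpoly) \<and>
      y \<in> Poly_Mapping.keys q}"
    unfolding q using keys_mult by blast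
  then obtain y where y: "exponent b = exponent a + y"
    by (auto simp: monomial_eq_single)
  show "\<forall>i<n. a $ i \<le> b $ i"
  proof (intro allI impI)
    fix i assume "i < n"
    have "Poly_Mapping.lookup (exponent b) i = Poly_Mapping.lookup (exponent a) i + Poly_Mapping.lookup y i"
      by (simp add: y lookup_add)
    then show "a $ i \<le> b $ i" using \<open>i < n\<close> assms by (simp add: lookup_exponent)
  qed
next
  assume le: "\<forall>i<n. a $ i \<le> b $ i"
  have "a + (b - a) = b" using assms le by (intro eq_vecI) auto
  then have "(monomial b :: 'k mpoly) = monomial a * monomial (b - a)"
    using assms by (subst monomial_mult[of _ n]) auto
  then show "(monomial a :: 'k mpoly) dvd monomial b" by (rule dvdI)
qed

lemma polys_add: "p \<in> polys n \<Longrightarrow> q \<in> polys n \<Longrightarrow> p + q \<in> polys n"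
  using keys_add[of p q] by (fastforce simp: polys_def)

lemma polys_mult:
  assumes "p \<in> polys n" "q \<in> polys n"
  shows "p * q \<in> polys n"
  unfolding polys_def
proof (intro CollectI ballI)
  fix m assume "m \<in> Poly_Mapping.keys (p * q)"
  then obtain x y where m: "m = x + y" "x \<in> Poly_Mapping.keys p" "y \<in> Poly_Mapping.keys q"
    using keys_mult[of p q] by blast
  then have "Poly_Mapping.keys x \<subseteq> {..<n}" "Poly_Mapping.keys y \<subseteq> {..<n}"
    using assms by (auto simp: polys_def)
  then show "Poly_Mapping.keys m \<subseteq> {..<n}"
    using keys_add[of x y] by (auto simp: m(1))
qed

lemma polys_zero: "0 \<in> polys n"
  by (simp add: polys_def)

lemma polys_one: "1 \<in> polys n"
  by (simp add: polys_def)

lemma monomial_in_polys: "a \<in> carrier_vec n \<Longrightarrow> monomial a \<in> polys n"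
  using keys_exponent_subset[of a] by (auto simp: polys_def monomial_eq_single)

lemma ideal_generatedI:
  assumes "finite F" "F \<subseteq> B" "\<forall>b\<in>F. q b \<in> polys n" "p = (\<Sum>b\<in>F. q b * b)"
  shows "p \<in> ideal_generated n B"
  using assms unfolding ideal_generated_def by blast

lemma ideal_generatedE:
  assumes "p \<in> ideal_generated n B"
  obtains F q where "finite F" "F \<subseteq> B" "\<forall>b\<in>F. q b \<in> polys n" "p = (\<Sum>b\<in>F. q b * b)"
  using assms unfolding ideal_generated_def by blast

lemma ideal_generated_base: "b \<in> B \<Longrightarrow> b \<in> ideal_generated n B"
  by (rule ideal_generatedI[of "{b}" _ "\<lambda>_. 1"]) (auto simp: polys_one)

lemma ideal_generated_zero: "0 \<in> ideal_generated n B"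
  by (rule ideal_generatedI[of "{}" _ "\<lambda>_. 1"]) auto

lemma ideal_generated_add:
  assumes "p \<in> ideal_generated n B" "p' \<in> ideal_generated n B"
  shows "p + p' \<in> ideal_generated n B"
proof -
  obtain F q where F: "finite F" "F \<subseteq> B" "\<forall>b\<in>F. q b \<in> polys n" "p = (\<Sum>b\<in>F. q b * b)"
    using assms(1) by (rule ideal_generatedE)
  obtain F' q' where F': "finite F'" "F' \<subseteq> B" "\<forall>b\<in>F'. q' b \<in> polys n"
      "p' = (\<Sum>b\<in>F'. q' b * b)"
    using assms(2) by (rule ideal_generatedE)
  have "p = (\<Sum>b\<in>F \<union> F'. (if b \<in> F then q b else 0) * b)"
    unfolding F(4) using F(1) F'(1) by (intro sum.mono_neutral_cong_left) auto
  moreover have "p' = (\<Sum>b\<in>F \<union> F'. (if b \<in> F' then q' b else 0) * b)"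
    unfolding F'(4) using F(1) F'(1) by (intro sum.mono_neutral_cong_left) auto
  ultimately have "p + p' = (\<Sum>b\<in>F \<union> F'. ((if b \<in> F then q b else 0) + (if b \<in> F' then q' b else 0)) * b)"
    by (simp add: sum.distrib distrib_right)
  then show ?thesis
    by (intro ideal_generatedI[of "F \<union> F'"])
       (use F F' in \<open>auto intro!: polys_add simp: polys_zero\<close>)
qed

lemma ideal_generated_mult:
  assumes "r \<in> polys n" "p \<in> ideal_generated n B"
  shows "r * p \<in> ideal_generated n B"
proof -
  obtain F q where F: "finite F" "F \<subseteq> B" "\<forall>b\<in>F. q b \<in> polys n" "p = (\<Sum>b\<in>F. q b * b)"
    using assms(2) by (rule ideal_generatedE)
  show ?thesis
    by (rule ideal_generatedI[of F _ "\<lambda>b. r * q b"])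
       (use F assms(1) in \<open>auto simp: sum_distrib_left mult.assoc intro: polys_mult\<close>)
qed

lemma ideal_generated_subset:
  assumes "B \<subseteq> ideal_generated n B'"
  shows "ideal_generated n B \<subseteq> ideal_generated n B'"
proof
  fix p assume "p \<in> ideal_generated n B"
  then obtain F q where F: "finite F" "F \<subseteq> B" "\<forall>b\<in>F. q b \<in> polys n" "p = (\<Sum>b\<in>F. q b * b)"
    by (rule ideal_generatedE)
  have "(\<Sum>b\<in>F. q b * b) \<in> ideal_generated n B'"
    using F(1,2,3)
  proof (induction F rule: finite_induct)
    case empty
    then show ?case by (simp add: ideal_generated_zero)
  next
    case (insert x F)
    then show ?case using assms
      by (auto intro!: ideal_generated_add ideal_generated_mult)
  qed
  then show "p \<in> ideal_generated n B'" by (simp add: F(4))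
qed

lemma ideal_generated_mono: "B \<subseteq> B' \<Longrightarrow> ideal_generated n B \<subseteq> ideal_generated n B'"
  by (rule ideal_generated_subset) (auto intro: ideal_generated_base)

lemma ideal_generated_finite_support:
  assumes "finite S" "S \<subseteq> ideal_generated n B"
  obtains F where "finite F" "F \<subseteq> B" "S \<subseteq> ideal_generated n F"
proof -
  have "\<exists>F. finite F \<and> F \<subseteq> B \<and> S \<subseteq> ideal_generated n F"
    using assms
  proof (induction S rule: finite_induct)
    case (insert x S)
    then obtain F where F: "finite F" "F \<subseteq> B" "S \<subseteq> ideal_generated n F" by auto
    have "x \<in> ideal_generated n B" using insert by auto
    then obtain F' where F': "finite F'" "F' \<subseteq> B" "x \<in> ideal_generated n F'"
      using ideal_generatedI by (elim ideal_generatedE) blast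
    show ?case
      by (rule exI[of _ "F \<union> F'"])
         (use F F' ideal_generated_mono[of F "F \<union> F'" n] ideal_generated_mono[of F' "F \<union> F'" n] in auto)
  qed auto
  then show thesis using that by blast
qed

text \<open>The linear functional on polynomials that sends the monomial with exponent \<open>m\<close> to \<open>h m\<close>. With \<open>h\<close>
  the indicator of a class of exponents it sums the coefficients of the monomials of that class;
  that sum is an invariant which separates binomials from the ideals that do not contain them.\<close>

definition weigh :: "((nat \<Rightarrow>\<^sub>0 nat) \<Rightarrow> 'k::field) \<Rightarrow> 'k mpoly \<Rightarrow> 'k" where
  "weigh h p = (\<Sum>m\<in>Poly_Mapping.keys p. Poly_Mapping.lookup p m * h m)"

lemma weigh_superset:
  assumes "finite M" "Poly_Mapping.keys p \<subseteq> M"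
  shows "weigh h p = (\<Sum>m\<in>M. Poly_Mapping.lookup p m * h m)"
  unfolding weigh_def using assms
  by (intro sum.mono_neutral_left) (auto simp: in_keys_iff)

lemma weigh_add: "weigh h (p + q) = weigh h p + weigh h q"
proof -
  let ?M = "Poly_Mapping.keys p \<union> Poly_Mapping.keys q"
  have "weigh h (p + q) = (\<Sum>m\<in>?M. Poly_Mapping.lookup (p + q) m * h m)"
    by (rule weigh_superset) (use keys_add[of p q] in auto)
  also have "\<dots> = (\<Sum>m\<in>?M. Poly_Mapping.lookup p m * h m) + (\<Sum>m\<in>?M. Poly_Mapping.lookup q m * h m)"
    by (simp add: lookup_add distrib_right sum.distrib)
  also have "\<dots> = weigh h p + weigh h q"
    by (simp add: weigh_superset[of ?M p] weigh_superset[of ?M q])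
  finally show ?thesis .
qed

lemma weigh_zero: "weigh h 0 = 0"
  by (simp add: weigh_def)

lemma weigh_sum: "weigh h (sum f S) = (\<Sum>x\<in>S. weigh h (f x))"
  by (induction S rule: infinite_finite_induct) (auto simp: weigh_zero weigh_add)

lemma weigh_diff: "weigh h (p - q) = weigh h p - weigh h q"
  using weigh_add[of h "p - q" q] by simp

lemma weigh_single: "weigh h (Poly_Mapping.single m c) = c * h m"
  by (cases "c = 0") (auto simp: weigh_def)

lemma weigh_monomial: "weigh h (monomial a) = h (exponent a)"
  by (simp add: monomial_eq_single weigh_single)

lemma poly_mapping_as_sum:
  "p = (\<Sum>m\<in>Poly_Mapping.keys p. Poly_Mapping.single m (Poly_Mapping.lookup p m))"
proof (rule poly_mapping_eqI)
  fix k
  show "Poly_Mapping.lookup p k =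
      Poly_Mapping.lookup (\<Sum>m\<in>Poly_Mapping.keys p. Poly_Mapping.single m (Poly_Mapping.lookup p m)) k"
    unfolding lookup_sum
    by (cases "k \<in> Poly_Mapping.keys p")
       (auto simp: lookup_single when_def in_keys_iff if_distrib cong: if_cong)
qed

text \<open>A weight that agrees on the two terms of every monomial multiple of a generating binomial kills
  the whole ideal.\<close>

lemma weigh_ideal_eq_zero:
  assumes p: "p \<in> ideal_generated n B"
    and B: "\<And>b. b \<in> B \<Longrightarrow> \<exists>c d. b = monomial c - monomial d \<and>
      (\<forall>m. Poly_Mapping.keys m \<subseteq> {..<n} \<longrightarrow> h (m + exponent c) = h (m + exponent d))"
  shows "weigh h p = 0"
proof -
  obtain F q where F: "finite F" "F \<subseteq> B" "\<forall>b\<in>F. q b \<in> polys n" "p = (\<Sum>b\<in>F. q b * b)"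
    using p by (rule ideal_generatedE)
  have "weigh h (q b * b) = 0" if bF: "b \<in> F" for b
  proof -
    obtain c d where b: "b = monomial c - monomial d"
      and h: "\<forall>m. Poly_Mapping.keys m \<subseteq> {..<n} \<longrightarrow> h (m + exponent c) = h (m + exponent d)"
      using B[of b] F(2) bF by blast
    have "q b * b = (\<Sum>m\<in>Poly_Mapping.keys (q b). Poly_Mapping.single m (Poly_Mapping.lookup (q b) m)) * b"
      using poly_mapping_as_sum[of "q b"] by simp
    also have "\<dots> = (\<Sum>m\<in>Poly_Mapping.keys (q b).
        Poly_Mapping.single (m + exponent c) (Poly_Mapping.lookup (q b) m) -
        Poly_Mapping.single (m + exponent d) (Poly_Mapping.lookup (q b) m))"
      by (simp add: b monomial_eq_single sum_distrib_right right_diff_distrib mult_single sum_subtractf)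
    finally have "weigh h (q b * b) = (\<Sum>m\<in>Poly_Mapping.keys (q b).
        Poly_Mapping.lookup (q b) m * h (m + exponent c) - Poly_Mapping.lookup (q b) m * h (m + exponent d))"
      by (simp add: weigh_sum weigh_diff weigh_single)
    also have "\<dots> = 0"
    proof (intro sum.neutral ballI)
      fix m assume "m \<in> Poly_Mapping.keys (q b)"
      then have "Poly_Mapping.keys m \<subseteq> {..<n}" using F(3) bF by (auto simp: polys_def)
      then show "Poly_Mapping.lookup (q b) m * h (m + exponent c) -
          Poly_Mapping.lookup (q b) m * h (m + exponent d) = 0" using h by simp
    qed
    finally show ?thesis .
  qed
  then show ?thesis by (simp add: F(4) weigh_sum)
qed

section \<open>Binomials of a toric ideal\<close>

lemma mat_kernel_carrier_vec: "u \<in> mat_kernel M \<Longrightarrow> u \<in> carrier_vec (dim_col M)"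
  by (simp add: mat_kernel_def)

lemma mat_kernel_add:
  assumes "u \<in> mat_kernel M" "v \<in> mat_kernel M"
  shows "u + v \<in> mat_kernel M"
proof -
  have "M *\<^sub>v (u + v) = M *\<^sub>v u + M *\<^sub>v v"
    using assms by (intro mult_add_distrib_mat_vec[of _ "dim_row M" "dim_col M"]) (auto simp: mat_kernel_def)
  then show ?thesis using assms by (auto simp: mat_kernel_def)
qed

lemma mat_kernel_uminus:
  fixes M :: "int mat"
  assumes "u \<in> mat_kernel M"
  shows "- u \<in> mat_kernel M"
proof -
  have "- u = (- 1) \<cdot>\<^sub>v u" by (intro eq_vecI) auto
  then show ?thesis using mat_kernel_smult[OF _ assms, of "dim_row M" "dim_col M" "- 1"] by simp
qed

lemma mat_kernel_diff:
  fixes M :: "int mat"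
  assumes "u \<in> mat_kernel M" "v \<in> mat_kernel M"
  shows "u - v \<in> mat_kernel M"
proof -
  have "u - v = u + (- v)"
    using assms[THEN mat_kernel_carrier_vec] by (intro eq_vecI) auto
  then show ?thesis using mat_kernel_add[OF assms(1) mat_kernel_uminus[OF assms(2)]] by simp
qed

lemma pos_part_carrier [simp]: "u \<in> carrier_vec n \<Longrightarrow> pos_part u \<in> carrier_vec n"
  by (simp add: pos_part_def)

lemma neg_part_carrier [simp]: "u \<in> carrier_vec n \<Longrightarrow> neg_part u \<in> carrier_vec n"
  by (simp add: neg_part_def)

lemma dim_pos_part [simp]: "dim_vec (pos_part u) = dim_vec u"
  by (simp add: pos_part_def)

lemma dim_neg_part [simp]: "dim_vec (neg_part u) = dim_vec u"
  by (simp add: neg_part_def)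

lemma pos_part_index [simp]: "i < dim_vec u \<Longrightarrow> pos_part u $ i = nat (u $ i)"
  by (simp add: pos_part_def)

lemma neg_part_index [simp]: "i < dim_vec u \<Longrightarrow> neg_part u $ i = nat (- u $ i)"
  by (simp add: neg_part_def)

lemma uminus_binomial_of: "- binomial_of u = binomial_of (- u)"
proof -
  have "pos_part (- u) = neg_part u" "neg_part (- u) = pos_part u"
    by (auto intro!: eq_vecI)
  then show ?thesis by (simp add: binomial_of_def)
qed

lemma parts_diff:
  "u \<in> carrier_vec n \<Longrightarrow> map_vec int (pos_part u) - map_vec int (neg_part u) = u"
  by (auto intro!: eq_vecI)

text \<open>Membership in the toric ideal is decided by the weight that is the indicator of the exponents
  congruent to \<open>c\<close> modulo the lattice \<open>Ker\<^sub>\<int>(M)\<close>.\<close>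

lemma monomial_diff_in_toric_ideal:
  assumes c: "c \<in> carrier_vec (dim_col M)" and d: "d \<in> carrier_vec (dim_col M)"
    and mem: "(monomial c - monomial d :: 'k::field mpoly) \<in> toric_ideal M"
  shows "map_vec int c - map_vec int d \<in> mat_kernel M"
proof -
  define n where "n = dim_col M"
  define offset where "offset x = vec n (\<lambda>i. int (Poly_Mapping.lookup (exponent c) i) -
    int (Poly_Mapping.lookup x i))" for x
  define h :: "(nat \<Rightarrow>\<^sub>0 nat) \<Rightarrow> 'k" where "h x = (if offset x \<in> mat_kernel M then 1 else 0)" for x
  have "weigh h (monomial c - monomial d :: 'k mpoly) = 0"
  proof (rule weigh_ideal_eq_zero[OF mem[unfolded toric_ideal_def]])
    fix b :: "'k mpoly" assume "b \<in> binomial_of ` mat_kernel M"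
    then obtain u where u: "u \<in> mat_kernel M" "b = monomial (pos_part u) - monomial (neg_part u)"
      by (auto simp: binomial_of_def)
    have un: "u \<in> carrier_vec n" using u(1) by (simp add: mat_kernel_def n_def)
    have "h (m + exponent (pos_part u)) = h (m + exponent (neg_part u))" for m
    proof -
      have "offset (m + exponent (neg_part u)) = offset (m + exponent (pos_part u)) + u"
        using un by (intro eq_vecI) (auto simp: offset_def lookup_add lookup_exponent)
      moreover have "offset (m + exponent (pos_part u)) = offset (m + exponent (neg_part u)) - u"
        using un by (intro eq_vecI) (auto simp: offset_def lookup_add lookup_exponent)
      ultimately show ?thesis using mat_kernel_add[OF _ u(1)] mat_kernel_diff[OF _ u(1)]
        unfolding h_def by metis
    qed
    then show "\<exists>c d. b = monomial c - monomial d \<and>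
      (\<forall>m. Poly_Mapping.keys m \<subseteq> {..<dim_col M} \<longrightarrow> h (m + exponent c) = h (m + exponent d))"
      using u(2) by blast
  qed
  then have same: "h (exponent c) = h (exponent d)" by (simp add: weigh_diff weigh_monomial)
  have "offset (exponent c) = 0\<^sub>v n" by (intro eq_vecI) (auto simp: offset_def)
  moreover have "0\<^sub>v n \<in> mat_kernel M" by (auto simp: mat_kernel_def n_def intro!: eq_vecI)
  ultimately have "h (exponent c) = 1" by (simp add: h_def)
  then have "offset (exponent d) \<in> mat_kernel M" using same by (simp add: h_def split: if_splits)
  moreover have "offset (exponent d) = map_vec int c - map_vec int d"
    using c d by (intro eq_vecI) (auto simp: offset_def n_def lookup_exponent)
  ultimately show ?thesis by simp
qed

lemma binomial_of_in_toric_ideal_iff: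
  assumes "u \<in> carrier_vec (dim_col M)"
  shows "(binomial_of u :: 'k::field mpoly) \<in> toric_ideal M \<longleftrightarrow> u \<in> mat_kernel M"
proof
  assume "(binomial_of u :: 'k mpoly) \<in> toric_ideal M"
  then have "map_vec int (pos_part u) - map_vec int (neg_part u) \<in> mat_kernel M"
    using assms by (intro monomial_diff_in_toric_ideal[where 'k='k]) (auto simp: binomial_of_def)
  then show "u \<in> mat_kernel M" using parts_diff[OF assms] by simp
next
  assume "u \<in> mat_kernel M"
  then show "(binomial_of u :: 'k mpoly) \<in> toric_ideal M"
    unfolding toric_ideal_def by (intro ideal_generated_base) auto
qed

text \<open>A toric ideal determines its lattice.\<close>

lemma toric_ideal_eq_imp_kernel_eq:
  assumes "(toric_ideal M :: 'k::field mpoly set) = toric_ideal N" "dim_col M = dim_col N"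
  shows "mat_kernel M = mat_kernel N"
proof -
  have "u \<in> mat_kernel M \<longleftrightarrow> u \<in> mat_kernel N" if "u \<in> carrier_vec (dim_col M)" for u
    using binomial_of_in_toric_ideal_iff[where 'k='k] assms that by metis
  moreover have "mat_kernel M \<subseteq> carrier_vec (dim_col M)" "mat_kernel N \<subseteq> carrier_vec (dim_col M)"
    using assms(2) by (auto simp: mat_kernel_def)
  ultimately show ?thesis by blast
qed

lemma kernel_eq_imp_toric_ideal_eq:
  assumes "mat_kernel M = mat_kernel N" "dim_col M = dim_col N"
  shows "toric_ideal M = toric_ideal N"
  by (simp add: toric_ideal_def assms)

section \<open>Semiconformal splittings\<close>

text \<open>Divisibility of \<open>u\<^sup>+\<close> by \<open>v\<^sup>+\<close> and of \<open>u\<^sup>-\<close> by \<open>v\<^sup>-\<close> as monomials.\<close>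

definition conformally_below :: "int vec \<Rightarrow> int vec \<Rightarrow> bool" where
  "conformally_below v u \<longleftrightarrow>
     (\<forall>i<dim_vec u. nat (v $ i) \<le> nat (u $ i) \<and> nat (- v $ i) \<le> nat (- u $ i))"

text \<open>This interpolates between the semiconformal decompositions (\<open>\<omega> = UNIV\<close>), which govern
  indispensability, and the conformal ones (\<open>\<omega> = {}\<close>), which govern the Graver basis. The intermediate
  cases are what semiconformality in \<open>Ker\<^sub>\<int>(A)\<close> amounts to in \<open>Ker\<^sub>\<int>(T)\<close> if \<open>\<omega>\<close> indexes the non-mixed
  bouquets.\<close>

definition splits :: "nat set \<Rightarrow> int mat \<Rightarrow> int vec \<Rightarrow> bool" where
  "splits \<omega> M u \<longleftrightarrow> (\<exists>v \<in> mat_kernel M. \<exists>w \<in> mat_kernel M.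
     v \<noteq> 0\<^sub>v (dim_col M) \<and> w \<noteq> 0\<^sub>v (dim_col M) \<and> u = v + w \<and>
     (\<forall>i<dim_col M. \<not> (v $ i > 0 \<and> w $ i < 0) \<and> (i \<notin> \<omega> \<longrightarrow> \<not> (v $ i < 0 \<and> w $ i > 0))))"

lemma splits_mono: "splits \<tau> M u \<Longrightarrow> \<tau> \<subseteq> \<sigma> \<Longrightarrow> splits \<sigma> M u"
  unfolding splits_def by blast

lemma zero_in_mat_kernel: "0\<^sub>v (dim_col M) \<in> mat_kernel (M :: int mat)"
  by (auto simp: mat_kernel_def intro!: eq_vecI)

lemma dim_kernel: "u \<in> mat_kernel M \<Longrightarrow> dim_vec u = dim_col M"
  by (auto simp: mat_kernel_def)

lemma graver_iff:
  "u \<in> graver TYPE('k::field) M \<longleftrightarrow> u \<in> mat_kernel M \<and> u \<noteq> 0\<^sub>v (dim_col M) \<and>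
     (\<forall>v\<in>mat_kernel M. v \<noteq> 0\<^sub>v (dim_col M) \<longrightarrow> conformally_below v u \<longrightarrow> v = u)"
proof -
  have below: "(monomial (pos_part v) :: 'k mpoly) dvd monomial (pos_part u) \<and>
      (monomial (neg_part v) :: 'k mpoly) dvd monomial (neg_part u) \<longleftrightarrow> conformally_below v u"
    if "u \<in> carrier_vec (dim_col M)" "v \<in> carrier_vec (dim_col M)" for u v
    using that monomial_dvd_iff[of "pos_part v" "dim_col M" "pos_part u", where 'k='k]
      monomial_dvd_iff[of "neg_part v" "dim_col M" "neg_part u", where 'k='k]
    by (auto simp: conformally_below_def)
  show ?thesis
    unfolding graver_def mem_Collect_eq
    using below binomial_of_in_toric_ideal_iff[where 'k='k and M=M] mat_kernel_carrier_vec[of _ M] by blast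
qed

text \<open>A Graver element is minimal, and the summands of a conformal sum lie below the sum.\<close>

lemma graver_not_splits:
  assumes "u \<in> graver TYPE('k::field) M"
  shows "\<not> splits {} M u"
proof
  assume "splits {} M u"
  then obtain v w where vw: "v \<in> mat_kernel M" "w \<in> mat_kernel M" "v \<noteq> 0\<^sub>v (dim_col M)"
      "w \<noteq> 0\<^sub>v (dim_col M)" "u = v + w"
    and conf: "\<forall>i<dim_col M. \<not> (v $ i > 0 \<and> w $ i < 0) \<and> \<not> (v $ i < 0 \<and> w $ i > 0)"
    unfolding splits_def by blast
  note dims = dim_kernel[OF vw(1)] dim_kernel[OF vw(2)]
  have "conformally_below v u"
    unfolding conformally_below_def vw(5)
  proof (intro allI impI)
    fix i assume "i < dim_vec (v + w)"
    then show "nat (v $ i) \<le> nat ((v + w) $ i) \<and> nat (- v $ i) \<le> nat (- (v + w) $ i)"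
      using conf[rule_format, of i] dims by auto
  qed
  then have "v = u" using assms vw graver_iff by blast
  have "w = 0\<^sub>v (dim_col M)"
  proof (intro eq_vecI)
    fix i assume "i < dim_vec (0\<^sub>v (dim_col M) :: int vec)"
    then show "w $ i = 0\<^sub>v (dim_col M) $ i"
      using arg_cong[OF \<open>v = u\<close>, of "\<lambda>x. x $ i"] dims by (simp add: vw(5))
  qed (use dims in simp)
  then show False using vw by simp
qed

text \<open>Walk from \<open>u\<^sup>+\<close> to \<open>u\<^sup>-\<close> through \<open>u\<^sup>+ - v\<close>; semiconformality says that \<open>v\<^sup>+ \<le> u\<^sup>+\<close> and \<open>w\<^sup>- \<le> u\<^sup>-\<close>, which
  makes both steps monomial multiples of the binomials of the summands.\<close>

lemma binomial_of_semiconformal_sum: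
  assumes v: "v \<in> carrier_vec n" and w: "w \<in> carrier_vec n"
    and semi: "\<forall>i<n. \<not> (v $ i > 0 \<and> w $ i < 0)"
  obtains a b where "a \<in> carrier_vec n" "b \<in> carrier_vec n"
    "(binomial_of (v + w) :: 'k::field mpoly) = monomial a * binomial_of v + monomial b * binomial_of w"
proof
  define u where "u = v + w"
  define a where "a = pos_part u - pos_part v"
  define b where "b = neg_part u - neg_part w"
  note dims = carrier_vecD[OF v] carrier_vecD[OF w]
  show a: "a \<in> carrier_vec n" and b: "b \<in> carrier_vec n"
    using v w by (auto simp: a_def b_def u_def)
  have "a + pos_part v = pos_part u" "b + neg_part w = neg_part u"
      "a + neg_part v = b + pos_part w"
    using semi dims by (auto intro!: eq_vecI simp: a_def b_def u_def)
  then have "monomial a * monomial (pos_part v) = (monomial (pos_part u) :: 'k mpoly)"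
      "monomial b * monomial (neg_part w) = (monomial (neg_part u) :: 'k mpoly)"
      "monomial a * monomial (neg_part v) = (monomial b * monomial (pos_part w) :: 'k mpoly)"
    using a b v w by (simp_all add: monomial_mult[of _ n])
  then show "(binomial_of (v + w) :: 'k mpoly) = monomial a * binomial_of v + monomial b * binomial_of w"
    by (simp add: binomial_of_def u_def[symmetric] right_diff_distrib)
qed

lemma splitting_ideal_membership:
  assumes v: "v \<in> carrier_vec n" and w: "w \<in> carrier_vec n"
    and semi: "\<forall>i<n. \<not> (v $ i > 0 \<and> w $ i < 0)"
    and mem: "binomial_of v \<in> ideal_generated n B" "binomial_of w \<in> ideal_generated n B"
  shows "(binomial_of (v + w) :: 'k::field mpoly) \<in> ideal_generated n B"
proof -
  obtain a b where ab: "a \<in> carrier_vec n" "b \<in> carrier_vec n"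
    "(binomial_of (v + w) :: 'k mpoly) = monomial a * binomial_of v + monomial b * binomial_of w"
    using binomial_of_semiconformal_sum[OF v w semi] by metis
  then show ?thesis
    by (auto intro!: ideal_generated_add ideal_generated_mult monomial_in_polys mem)
qed

section \<open>Finite generation\<close>

text \<open>Dickson's lemma, obtained by refining the subsequence for one coordinate after the other.\<close>

lemma monotone_subsequence:
  fixes F :: "nat \<Rightarrow> nat \<Rightarrow> nat"
  shows "\<exists>r :: nat \<Rightarrow> nat. strict_mono r \<and> (\<forall>i<N. \<forall>k l. k \<le> l \<longrightarrow> F (r k) i \<le> F (r l) i)"
proof (induction N)
  case 0
  show ?case by (intro exI[of _ id]) (auto simp: strict_mono_def)
next
  case (Suc N)
  then obtain r :: "nat \<Rightarrow> nat" where r: "strict_mono r" "\<And>i k l. i < N \<Longrightarrow> k \<le> l \<Longrightarrow> F (r k) i \<le> F (r l) i" by blast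
  obtain g where g: "strict_mono g" "monoseq (\<lambda>k. F (r (g k)) N)"
    using seq_monosub[of "\<lambda>k. F (r k) N"] by auto
  have "\<exists>K. \<forall>k l. K \<le> k \<longrightarrow> k \<le> l \<longrightarrow> F (r (g k)) N \<le> F (r (g l)) N"
  proof (cases "\<forall>k l. k \<le> l \<longrightarrow> F (r (g k)) N \<le> F (r (g l)) N")
    case False
    then have dec: "\<And>k l. k \<le> l \<Longrightarrow> F (r (g l)) N \<le> F (r (g k)) N"
      using g(2) unfolding monoseq_def by blast
    \<comment> \<open>A decreasing sequence of natural numbers is constant from where it attains its minimum.\<close>
    obtain K where K: "\<And>k. F (r (g K)) N \<le> F (r (g k)) N"
      using ex_has_least_nat[of "\<lambda>_. True" 0 "\<lambda>k. F (r (g k)) N"] by auto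
    show ?thesis
      by (rule exI[of _ K]) (use K dec in \<open>meson order_trans\<close>)
  qed auto
  then obtain K where K: "\<And>k l. K \<le> k \<Longrightarrow> k \<le> l \<Longrightarrow> F (r (g k)) N \<le> F (r (g l)) N" by blast
  define q where "q k = r (g (K + k))" for k
  have q: "strict_mono q"
    using r(1) g(1) by (auto simp: q_def strict_mono_def)
  have gle: "g (K + k) \<le> g (K + l)" if "k \<le> l" for k l
    using g(1) that by (simp add: strict_mono_less_eq)
  have "F (q k) i \<le> F (q l) i" if "i < Suc N" "k \<le> l" for i k l
    using that K[of "K + k" "K + l"] r(2)[of i, OF _ gle[OF that(2)]]
    by (cases "i = N") (auto simp: q_def)
  then show ?case using q by blast
qed

text \<open>The Graver basis, described inside the lattice and independently of the field.\<close>

definition minimal_kernel_elements :: "int mat \<Rightarrow> int vec set" where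
  "minimal_kernel_elements M = {u \<in> mat_kernel M. u \<noteq> 0\<^sub>v (dim_col M) \<and>
     (\<forall>v\<in>mat_kernel M. v \<noteq> 0\<^sub>v (dim_col M) \<longrightarrow> conformally_below v u \<longrightarrow> v = u)}"

lemma finite_minimal_kernel_elements: "finite (minimal_kernel_elements M)"
proof (rule ccontr)
  let ?n = "dim_col M"
  assume "infinite (minimal_kernel_elements M)"
  then obtain f :: "nat \<Rightarrow> int vec" where f: "inj f" "range f \<subseteq> minimal_kernel_elements M"
    using infinite_countable_subset by blast
  define F where "F k i = (if i < ?n then nat (f k $ i) else nat (- f k $ (i - ?n)))" for k i
  obtain r :: "nat \<Rightarrow> nat" where r: "strict_mono r" "\<And>i k l. i < 2 * ?n \<Longrightarrow> k \<le> l \<Longrightarrow> F (r k) i \<le> F (r l) i"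
    using monotone_subsequence[of "2 * ?n" F] by blast
  have ker: "f k \<in> mat_kernel M" "f k \<noteq> 0\<^sub>v ?n" for k
    using f(2) by (auto simp: minimal_kernel_elements_def)
  have "conformally_below (f (r 0)) (f (r 1))"
    unfolding conformally_below_def
  proof (intro allI impI)
    fix i assume "i < dim_vec (f (r 1))"
    then have i: "i < ?n" using dim_kernel[OF ker(1)] by simp
    show "nat (f (r 0) $ i) \<le> nat (f (r 1) $ i) \<and> nat (- f (r 0) $ i) \<le> nat (- f (r 1) $ i)"
      using r(2)[of i 0 1] r(2)[of "?n + i" 0 1] i by (simp add: F_def)
  qed
  moreover have "f (r 1) \<in> minimal_kernel_elements M" using f(2) by auto
  ultimately have "f (r 0) = f (r 1)" using ker by (auto simp: minimal_kernel_elements_def)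
  moreover have "r 0 \<noteq> r 1" using r(1) by (metis strict_mono_eq zero_neq_one)
  ultimately show False using f(1) by (auto dest: injD)
qed

text \<open>Subtracting a conformally smaller element shortens a kernel element, so by induction on the
  length the minimal elements generate.\<close>

lemma binomial_of_in_minimal_ideal:
  assumes "u \<in> mat_kernel M"
  shows "(binomial_of u :: 'k::field mpoly) \<in>
    ideal_generated (dim_col M) (binomial_of ` minimal_kernel_elements M)"
  using assms
proof (induction "nat (\<Sum>i<dim_col M. \<bar>u $ i\<bar>)" arbitrary: u rule: less_induct)
  case less
  let ?n = "dim_col M"
  let ?I = "ideal_generated ?n (binomial_of ` minimal_kernel_elements M) :: 'k mpoly set"
  note u = less.prems
  consider "u = 0\<^sub>v ?n" | "u \<in> minimal_kernel_elements M"
    | v where "v \<in> mat_kernel M" "v \<noteq> 0\<^sub>v ?n" "conformally_below v u" "v \<noteq> u"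
    using u unfolding minimal_kernel_elements_def by blast
  then show ?case
  proof cases
    case 1
    have "pos_part (0\<^sub>v ?n) = neg_part (0\<^sub>v ?n)" by (auto intro!: eq_vecI)
    then have "(binomial_of u :: 'k mpoly) = 0"
      by (simp add: 1 binomial_of_def)
    then show ?thesis by (simp add: ideal_generated_zero)
  next
    case 2
    then show ?thesis by (auto intro: ideal_generated_base)
  next
    case (3 v)
    define w where "w = u - v"
    have w: "w \<in> mat_kernel M" unfolding w_def by (rule mat_kernel_diff) (use u 3 in auto)
    note dims = dim_kernel[OF u] dim_kernel[OF 3(1)]
    have uvw: "u = v + w" using dims by (auto intro!: eq_vecI simp: w_def)
    have conf: "nat (v $ i) \<le> nat (u $ i)" "nat (- v $ i) \<le> nat (- u $ i)" if "i < ?n" for i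
      using 3(3) that dims by (auto simp: conformally_below_def)
    have split: "\<bar>v $ i\<bar> + \<bar>w $ i\<bar> = \<bar>u $ i\<bar>" if "i < ?n" for i
      using conf[OF that] that dims by (auto simp: w_def)
    have total: "(\<Sum>i<?n. \<bar>v $ i\<bar>) + (\<Sum>i<?n. \<bar>w $ i\<bar>) = (\<Sum>i<?n. \<bar>u $ i\<bar>)"
      using split by (simp add: sum.distrib[symmetric])
    have pos: "(\<Sum>i<?n. \<bar>x $ i\<bar>) > 0" if x: "x \<in> mat_kernel M" "x \<noteq> 0\<^sub>v ?n" for x :: "int vec"
    proof -
      obtain i where "i < ?n" "x $ i \<noteq> 0"
        using x dim_kernel[OF x(1)] by (metis eq_vecI index_zero_vec)
      then show ?thesis by (intro sum_pos2[of _ i]) auto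
    qed
    have "w \<noteq> 0\<^sub>v ?n"
      using 3(4) uvw dims by (metis mat_kernel_carrier_vec[OF 3(1)] right_zero_vec)
    then have "(\<Sum>i<?n. \<bar>v $ i\<bar>) > 0" "(\<Sum>i<?n. \<bar>w $ i\<bar>) > 0"
      using pos 3 w by auto
    then have "binomial_of v \<in> ?I" "binomial_of w \<in> ?I"
      using less.hyps[of v] less.hyps[of w] 3(1) w total by auto
    moreover have "\<forall>i<?n. \<not> (v $ i > 0 \<and> w $ i < 0)"
    proof (intro allI impI notI)
      fix i assume i: "i < ?n" "v $ i > 0 \<and> w $ i < 0"
      then show False using split[OF i(1)] dims by (auto simp: uvw)
    qed
    ultimately show ?thesis unfolding uvw
      using 3(1) w by (intro splitting_ideal_membership) (auto intro: mat_kernel_carrier_vec)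
  qed
qed

lemma toric_ideal_finitely_generated:
  obtains S where "finite S" "S \<subseteq> toric_ideal M"
    "(toric_ideal M :: 'k::field mpoly set) = ideal_generated (dim_col M) S"
proof
  let ?S = "binomial_of ` minimal_kernel_elements M :: 'k mpoly set"
  show "finite ?S" using finite_minimal_kernel_elements by simp
  have sub: "?S \<subseteq> binomial_of ` mat_kernel M" by (auto simp: minimal_kernel_elements_def)
  then have "ideal_generated (dim_col M) ?S \<subseteq> toric_ideal M"
    unfolding toric_ideal_def by (rule ideal_generated_mono)
  moreover have "toric_ideal M \<subseteq> ideal_generated (dim_col M) ?S"
    unfolding toric_ideal_def
    by (intro ideal_generated_subset image_subsetI binomial_of_in_minimal_ideal)
  ultimately show "toric_ideal M = ideal_generated (dim_col M) ?S" by (rule equalityI[rotated])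
  then show "?S \<subseteq> toric_ideal M" using ideal_generated_base[of _ ?S] by (simp add: subset_iff)
qed

text \<open>Every binomial generating set contains a minimal one: only finitely many of its elements are
  needed for a finite generating set, and a generating subset of least size is minimal.\<close>

lemma minimal_binomial_generators_within:
  fixes E :: "'k::field mpoly set"
  assumes "E \<subseteq> binomials (dim_col M)" "ideal_generated (dim_col M) E = toric_ideal M"
  obtains B where "B \<subseteq> E" "minimal_binomial_generators M B"
proof -
  let ?n = "dim_col M"
  obtain S :: "'k mpoly set" where S: "finite S" "S \<subseteq> toric_ideal M" "toric_ideal M = ideal_generated ?n S"
    by (rule toric_ideal_finitely_generated)
  obtain F where F: "finite F" "F \<subseteq> E" "S \<subseteq> ideal_generated ?n F"
    using ideal_generated_finite_support[of S ?n E] S assms(2) by blast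
  have "ideal_generated ?n F = toric_ideal M"
    using ideal_generated_subset[OF F(3)] ideal_generated_mono[OF F(2)] S(3) assms(2) by blast
  then obtain B where B: "finite B \<and> B \<subseteq> E \<and> ideal_generated ?n B = toric_ideal M"
    and least: "\<And>B'. finite B' \<and> B' \<subseteq> E \<and> ideal_generated ?n B' = toric_ideal M \<Longrightarrow> card B \<le> card B'"
    using ex_has_least_nat[of "\<lambda>B. finite B \<and> B \<subseteq> E \<and> ideal_generated ?n B = toric_ideal M" F card] F
    by blast
  have "ideal_generated ?n B' \<noteq> toric_ideal M" if "B' \<subset> B" for B'
    using least[of B'] B that psubset_card_mono[of B B'] finite_subset[of B' B] by fastforce
  then have "minimal_binomial_generators M B"
    using B assms(1) by (auto simp: minimal_binomial_generators_def)
  then show thesis using that B by blast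
qed

section \<open>Indispensable binomials\<close>

lemma nonneg_kernel_element_eq_zero:
  assumes "positively_graded M" "u \<in> mat_kernel M" "\<forall>i<dim_col M. u $ i \<ge> 0"
  shows "u = 0\<^sub>v (dim_col M)"
  using assms unfolding positively_graded_def by blast

lemma parts_eq_imp_zero:
  assumes "u \<in> carrier_vec n" "pos_part u = neg_part u"
  shows "u = 0\<^sub>v n"
proof (intro eq_vecI)
  fix i assume "i < dim_vec (0\<^sub>v n :: int vec)"
  then show "u $ i = 0\<^sub>v n $ i"
    using arg_cong[OF assms(2), of "\<lambda>x. x $ i"] assms(1) by auto
qed (use assms in simp)

lemma parts_inject:
  assumes "u \<in> carrier_vec n" "v \<in> carrier_vec n" "pos_part u = pos_part v" "neg_part u = neg_part v"
  shows "u = v"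
  using parts_diff[OF assms(1)] parts_diff[OF assms(2)] unfolding assms(3,4) by (rule trans[OF sym])

lemma summand_eq_sum_imp_zero:
  fixes v w :: "int vec"
  assumes "v \<in> carrier_vec n" "w \<in> carrier_vec n" "v + w = v"
  shows "w = 0\<^sub>v n"
proof (intro eq_vecI)
  fix i assume "i < dim_vec (0\<^sub>v n :: int vec)"
  then show "w $ i = 0\<^sub>v n $ i"
    using arg_cong[OF assms(3), of "\<lambda>x. x $ i"] assms(1,2) by simp
qed (use assms in simp)

text \<open>Only the set of the two exponents is recovered, since in characteristic two a binomial equals
  its negative.\<close>

lemma binomial_of_eq_imp:
  assumes u: "u \<in> carrier_vec n" and v: "v \<in> carrier_vec n" "v \<noteq> 0\<^sub>v n"
    and eq: "(binomial_of u :: 'k::field mpoly) = binomial_of v"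
  shows "u = v \<or> u = - v"
proof -
  have keys: "Poly_Mapping.keys (binomial_of x :: 'k mpoly) =
      (if pos_part x = neg_part x then {} else {exponent (pos_part x), exponent (neg_part x)})"
    if "x \<in> carrier_vec n" for x
    using that exponent_inject[of "pos_part x" n "neg_part x"]
    by (auto simp: binomial_of_def monomial_eq_single in_keys_iff lookup_minus lookup_single when_def
        split: if_splits)
  have "pos_part v \<noteq> neg_part v" using parts_eq_imp_zero v by blast
  then have "{exponent (pos_part u), exponent (neg_part u)} = {exponent (pos_part v), exponent (neg_part v)}"
    using keys[OF u] keys[OF v(1)] eq by (auto split: if_splits)
  then consider "pos_part u = pos_part v" "neg_part u = neg_part v"
    | "pos_part u = neg_part v" "neg_part u = pos_part v"
    using u v by (auto simp: doubleton_eq_iff exponent_inject[of _ n])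
  then show ?thesis
  proof cases
    case 1
    then show ?thesis using parts_inject u v by blast
  next
    case 2
    moreover have "pos_part (- v) = neg_part v" "neg_part (- v) = pos_part v"
      by (auto intro!: eq_vecI)
    ultimately have "u = - v" using v by (intro parts_inject[OF u]) auto
    then show ?thesis ..
  qed
qed

text \<open>If \<open>u = v + w\<close> splits semiconformally, positivity of the grading keeps \<open>v\<close> and \<open>w\<close> away from \<open>\<plusminus>u\<close>.
  So the binomial of \<open>u\<close> is redundant among all binomials of the ideal, and some minimal generating
  set avoids it.\<close>

lemma splits_imp_not_indispensable:
  assumes pg: "positively_graded M" and split: "splits UNIV M u"
  shows "u \<notin> indispensable TYPE('k::field) M"
proof
  let ?n = "dim_col M"
  assume indisp: "u \<in> indispensable TYPE('k) M"
  then have uker: "u \<in> mat_kernel M" by (simp add: indispensable_def)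
  obtain v w where vw: "v \<in> mat_kernel M" "w \<in> mat_kernel M" "v \<noteq> 0\<^sub>v ?n" "w \<noteq> 0\<^sub>v ?n" "u = v + w"
    and semi: "\<forall>i<?n. \<not> (v $ i > 0 \<and> w $ i < 0)"
    using split unfolding splits_def by blast
  have carr: "u \<in> carrier_vec ?n" "v \<in> carrier_vec ?n" "w \<in> carrier_vec ?n"
    using uker vw mat_kernel_carrier_vec by auto
  have coord: "u $ i = v $ i + w $ i" if "i < ?n" for i
    using that carr by (simp add: vw(5))
  have "v \<noteq> u" using vw(4,5) summand_eq_sum_imp_zero[OF carr(2,3)] by auto
  moreover have "w \<noteq> u"
    using vw(3,5) summand_eq_sum_imp_zero[OF carr(3,2)] comm_add_vec[OF carr(2,3)] by auto
  moreover have "v \<noteq> - u"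
  proof
    assume v: "v = - u"
    have "\<forall>i<?n. u $ i \<ge> 0"
    proof (intro allI impI)
      fix i assume i: "i < ?n"
      then have "v $ i = - u $ i" using carr v by simp
      then show "u $ i \<ge> 0" using semi[rule_format, OF i] coord[OF i] by linarith
    qed
    then have u0: "u = 0\<^sub>v ?n" using nonneg_kernel_element_eq_zero[OF pg uker] by simp
    have "v = 0\<^sub>v ?n" unfolding v u0 by (intro eq_vecI) auto
    then show False using vw(3) by simp
  qed
  moreover have "w \<noteq> - u"
  proof
    assume w: "w = - u"
    have "\<forall>i<?n. w $ i \<ge> 0"
    proof (intro allI impI)
      fix i assume i: "i < ?n"
      then have "w $ i = - u $ i" using carr w by simp
      then show "w $ i \<ge> 0" using semi[rule_format, OF i] coord[OF i] by linarith
    qed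
    then show False using nonneg_kernel_element_eq_zero[OF pg vw(2)] vw(4) by simp
  qed
  moreover define E where "E = (binomial_of ` {x \<in> mat_kernel M. x \<noteq> 0\<^sub>v ?n \<and> x \<noteq> u \<and> x \<noteq> - u} :: 'k mpoly set)"
  ultimately have "binomial_of v \<in> ideal_generated ?n E" "binomial_of w \<in> ideal_generated ?n E"
    using vw by (auto intro!: ideal_generated_base)
  then have u_in: "(binomial_of u :: 'k mpoly) \<in> ideal_generated ?n E"
    unfolding vw(5) using carr semi by (intro splitting_ideal_membership) auto
  have "(- 1 :: 'k mpoly) \<in> polys ?n" by (simp add: polys_def)
  then have neg_in: "(binomial_of (- u) :: 'k mpoly) \<in> ideal_generated ?n E"
    using ideal_generated_mult[OF _ u_in, of "- 1"] by (simp add: uminus_binomial_of)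
  have "(binomial_of x :: 'k mpoly) \<in> ideal_generated ?n E" if x: "x \<in> mat_kernel M" for x
  proof (cases "x = 0\<^sub>v ?n")
    case True
    have "pos_part (0\<^sub>v ?n) = neg_part (0\<^sub>v ?n)" by (auto intro!: eq_vecI)
    then show ?thesis by (simp add: True binomial_of_def ideal_generated_zero)
  next
    case False
    consider "x = u" | "x = - u" | "binomial_of x \<in> E" using x False by (auto simp: E_def)
    then show ?thesis using u_in neg_in ideal_generated_base by cases auto
  qed
  then have "toric_ideal M \<subseteq> ideal_generated ?n E"
    unfolding toric_ideal_def by (intro ideal_generated_subset) auto
  moreover have "ideal_generated ?n E \<subseteq> toric_ideal M"
    unfolding toric_ideal_def by (intro ideal_generated_mono) (auto simp: E_def)
  moreover have "E \<subseteq> binomials ?n"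
  proof
    fix b assume "b \<in> E"
    then obtain x where x: "x \<in> mat_kernel M" "x \<noteq> 0\<^sub>v ?n" "b = binomial_of x" by (auto simp: E_def)
    have xc: "x \<in> carrier_vec ?n" using x(1) by (rule mat_kernel_carrier_vec)
    then have "pos_part x \<noteq> neg_part x" using x(2) parts_eq_imp_zero by blast
    then show "b \<in> binomials ?n"
      unfolding binomials_def x(3) binomial_of_def using pos_part_carrier[OF xc] neg_part_carrier[OF xc] by blast
  qed
  ultimately obtain B where B: "B \<subseteq> E" "minimal_binomial_generators M B"
    using minimal_binomial_generators_within[of E M] by blast
  have "binomial_of u \<notin> E \<and> - binomial_of u \<notin> E"
  proof (intro conjI notI)
    assume "binomial_of u \<in> E"
    then obtain x where x: "x \<in> mat_kernel M" "x \<noteq> 0\<^sub>v ?n" "x \<noteq> u" "x \<noteq> - u"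
        "(binomial_of u :: 'k mpoly) = binomial_of x"
      by (auto simp: E_def)
    then have "u = x \<or> u = - x"
      using binomial_of_eq_imp[OF carr(1) mat_kernel_carrier_vec[OF x(1)] x(2,5)] by simp
    then show False using x by auto
  next
    assume "- binomial_of u \<in> E"
    then obtain x where x: "x \<in> mat_kernel M" "x \<noteq> 0\<^sub>v ?n" "x \<noteq> u" "x \<noteq> - u"
        "(binomial_of (- u) :: 'k mpoly) = binomial_of x"
      by (auto simp: E_def uminus_binomial_of)
    then have "- u = x \<or> - u = - x"
      using binomial_of_eq_imp[OF _ mat_kernel_carrier_vec[OF x(1)] x(2,5)] carr(1) by simp
    then show False using x by auto
  qed
  then show False using indisp B unfolding indispensable_def by blast
qed

text \<open>Conversely, let \<open>B\<close> generate. The exponents \<open>u\<^sup>+\<close> and \<open>u\<^sup>-\<close> are joined by a path whose steps are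
  monomial multiples of elements of \<open>B\<close>, as the indicator of a path component is a weight that kills the
  ideal. The first step subtracts some \<open>v\<close> with \<open>v\<^sup>+ \<le> u\<^sup>+\<close> and reaches an exponent \<open>u\<^sup>- + (u - v) \<ge> 0\<close>, so
  \<open>u = v + (u - v)\<close> is semiconformal. If \<open>u\<close> does not split, the first step is the whole path and, as
  \<open>u\<^sup>+\<close> and \<open>u\<^sup>-\<close> are coprime, it is an element of \<open>B\<close> itself.\<close>

lemma not_splits_imp_indispensable:
  assumes u: "u \<in> mat_kernel M" "u \<noteq> 0\<^sub>v (dim_col M)" and nsplit: "\<not> splits UNIV M u"
  shows "u \<in> indispensable TYPE('k::field) M"
  unfolding indispensable_def mem_Collect_eq
proof (intro conjI allI impI u(1))
  fix B :: "'k mpoly set"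
  let ?n = "dim_col M"
  assume "minimal_binomial_generators M B"
  then have Bbin: "B \<subseteq> binomials ?n" and Bgen: "ideal_generated ?n B = toric_ideal M"
    by (auto simp: minimal_binomial_generators_def)
  have uc: "u \<in> carrier_vec ?n" using u(1) by (rule mat_kernel_carrier_vec)
  define R where "R = {(x, y). \<exists>m c d. c \<in> carrier_vec ?n \<and> d \<in> carrier_vec ?n \<and>
    ((monomial c - monomial d :: 'k mpoly) \<in> B \<or> monomial d - monomial c \<in> B) \<and>
    x = m + exponent c \<and> y = m + exponent d}"
  have symR: "(y, x) \<in> R" if "(x, y) \<in> R" for x y
    using that unfolding R_def by blast
  let ?p = "exponent (pos_part u)" and ?q = "exponent (neg_part u)"
  define h :: "(nat \<Rightarrow>\<^sub>0 nat) \<Rightarrow> 'k" where "h x = (if (?p, x) \<in> R\<^sup>* then 1 else 0)" for x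
  have "weigh h (binomial_of u) = 0"
  proof (rule weigh_ideal_eq_zero)
    show "(binomial_of u :: 'k mpoly) \<in> ideal_generated ?n B"
      using binomial_of_in_toric_ideal_iff[OF uc, where 'k='k] u(1) Bgen by simp
    fix b assume "b \<in> B"
    then obtain c d where cd: "c \<in> carrier_vec ?n" "d \<in> carrier_vec ?n" "b = monomial c - monomial d"
      using Bbin by (auto simp: binomials_def)
    have "h (m + exponent c) = h (m + exponent d)" for m
    proof -
      have "(m + exponent c, m + exponent d) \<in> R"
        using cd \<open>b \<in> B\<close> unfolding R_def by blast
      then have "(?p, m + exponent c) \<in> R\<^sup>* \<longleftrightarrow> (?p, m + exponent d) \<in> R\<^sup>*"
        using symR by (meson rtrancl.rtrancl_into_rtrancl)
      then show ?thesis by (simp add: h_def)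
    qed
    then show "\<exists>c d. b = monomial c - monomial d \<and>
        (\<forall>m. Poly_Mapping.keys m \<subseteq> {..<?n} \<longrightarrow> h (m + exponent c) = h (m + exponent d))"
      using cd by blast
  qed
  then have "h ?q = h ?p" by (simp add: binomial_of_def weigh_diff weigh_monomial)
  then have path: "(?p, ?q) \<in> R\<^sup>*" by (simp add: h_def split: if_splits)
  have "pos_part u \<noteq> neg_part u" using u(2) uc parts_eq_imp_zero by blast
  then have "?p \<noteq> ?q" using uc by (simp add: exponent_inject[of _ ?n])
  then obtain y where "(?p, y) \<in> R" using path by (meson converse_rtranclE)
  then obtain m c d where cd: "c \<in> carrier_vec ?n" "d \<in> carrier_vec ?n"
      "(monomial c - monomial d :: 'k mpoly) \<in> B \<or> monomial d - monomial c \<in> B"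
      "?p = m + exponent c"
    unfolding R_def mem_Collect_eq case_prod_conv by (elim exE conjE) (rule that; assumption)
  define v where "v = map_vec int c - map_vec int d"
  have mem: "(monomial c - monomial d :: 'k mpoly) \<in> toric_ideal M \<or>
      (monomial d - monomial c :: 'k mpoly) \<in> toric_ideal M"
    unfolding Bgen[symmetric] using cd(3) ideal_generated_base[of _ B ?n] by metis
  then have v: "v \<in> mat_kernel M"
  proof
    assume "(monomial d - monomial c :: 'k mpoly) \<in> toric_ideal M"
    then have "map_vec int d - map_vec int c \<in> mat_kernel M"
      by (rule monomial_diff_in_toric_ideal[OF cd(2,1)])
    moreover have "v = - (map_vec int d - map_vec int c)"
      using cd by (auto simp: v_def intro!: eq_vecI)
    ultimately show ?thesis using mat_kernel_uminus by metis
  qed (unfold v_def, rule monomial_diff_in_toric_ideal[OF cd(1,2)])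
  have "c \<noteq> d"
  proof
    assume "c = d"
    then have "(0 :: 'k mpoly) \<in> binomials ?n" using cd(3) Bbin by auto
    then obtain a b where ab: "a \<in> carrier_vec ?n" "b \<in> carrier_vec ?n" "a \<noteq> b"
        "(0 :: 'k mpoly) = monomial a - monomial b"
      unfolding binomials_def by blast
    then have "(monomial a :: 'k mpoly) = monomial b" by simp
    then have "exponent a = exponent b"
      by (metis monomial_eq_single keys_single singleton_inject zero_neq_one)
    then show False using ab exponent_inject by blast
  qed
  have v0: "v \<noteq> 0\<^sub>v ?n"
  proof
    assume v0: "v = 0\<^sub>v ?n"
    have "c = d"
    proof (intro eq_vecI)
      fix i assume "i < dim_vec d"
      then show "c $ i = d $ i"
        using arg_cong[OF v0, of "\<lambda>x. x $ i"] cd by (auto simp: v_def)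
    qed (use cd in auto)
    then show False using \<open>c \<noteq> d\<close> by simp
  qed
  define w where "w = u - v"
  have w: "w \<in> mat_kernel M" unfolding w_def by (rule mat_kernel_diff[OF u(1) v])
  have vc: "v \<in> carrier_vec ?n" using v by (rule mat_kernel_carrier_vec)
  have uvw: "u = v + w" using uc vc by (auto simp: w_def intro!: eq_vecI)
  have c_le: "c $ i \<le> nat (u $ i)" if "i < ?n" for i
    using arg_cong[OF cd(4), of "\<lambda>x. Poly_Mapping.lookup x i"] that uc cd(1)
    by (simp_all add: lookup_add lookup_exponent)
  have vi: "v $ i = int (c $ i) - int (d $ i)" if "i < ?n" for i
    using that cd by (simp add: v_def)
  have "\<not> (v $ i > 0 \<and> w $ i < 0)" if i: "i < ?n" for i
  proof -
    have "w $ i = u $ i - v $ i" using i uc vc by (simp add: w_def)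
    then show ?thesis using c_le[OF i] vi[OF i] by linarith
  qed
  then have "w = 0\<^sub>v ?n"
    using nsplit v w v0 uvw unfolding splits_def by blast
  then have "u = v" using vc by (simp add: uvw)
  have "c = pos_part u" "d = neg_part u"
  proof -
    have "c $ i = nat (u $ i) \<and> d $ i = nat (- u $ i)" if i: "i < ?n" for i
    proof -
      have "u $ i = int (c $ i) - int (d $ i)" using vi[OF i] \<open>u = v\<close> by simp
      then show ?thesis using c_le[OF i] by auto
    qed
    then show "c = pos_part u" "d = neg_part u"
      using uc cd by (auto intro!: eq_vecI)
  qed
  then show "binomial_of u \<in> B \<or> - binomial_of u \<in> B"
    using cd(3) by (simp add: binomial_of_def)
qed

section \<open>Gale transforms and bouquets\<close>

lemma gale_in_kernel:
  "gale_transform M G \<Longrightarrow> x \<in> carrier_vec (dim_col G) \<Longrightarrow> G *\<^sub>v x \<in> mat_kernel M"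
  unfolding gale_transform_def bij_betw_def by blast

lemma gale_surj:
  assumes "gale_transform M G" "u \<in> mat_kernel M"
  obtains x where "x \<in> carrier_vec (dim_col G)" "u = G *\<^sub>v x"
  using assms unfolding gale_transform_def bij_betw_def by blast

lemma gale_inj:
  assumes "gale_transform M G" "x \<in> carrier_vec (dim_col G)" "y \<in> carrier_vec (dim_col G)"
    "G *\<^sub>v x = G *\<^sub>v y"
  shows "x = y"
  using assms unfolding gale_transform_def bij_betw_def inj_on_def by blast

lemma gale_dim_row: "gale_transform M G \<Longrightarrow> dim_row G = dim_col M"
  by (simp add: gale_transform_def)

lemma gale_column:
  assumes "gale_transform M G" "l < dim_col G"
  shows "col G l \<in> mat_kernel M"
proof -
  have "G *\<^sub>v unit_vec (dim_col G) l = col G l"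
    using assms(2) by (intro eq_vecI) (auto simp: scalar_prod_right_unit)
  then show ?thesis using gale_in_kernel[OF assms(1), of "unit_vec (dim_col G) l"] by simp
qed

text \<open>Proportionality of rows is a property of the lattice, hence the bouquets do not depend on
  the choice of the Gale transform.\<close>

lemma rat_row_proportional_iff:
  assumes "gale_transform M G" "i < dim_col M" "j < dim_col M"
  shows "rat_row G i = q \<cdot>\<^sub>v rat_row G j \<longleftrightarrow>
    (\<forall>u\<in>mat_kernel M. rat_of_int (u $ i) = q * rat_of_int (u $ j))"
proof
  note dim = gale_dim_row[OF assms(1)]
  assume eq: "rat_row G i = q \<cdot>\<^sub>v rat_row G j"
  have entry: "rat_of_int (G $$ (i, l)) = q * rat_of_int (G $$ (j, l))" if "l < dim_col G" for l
    using arg_cong[OF eq, of "\<lambda>x. x $ l"] that assms(2,3) dim by simp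
  show "\<forall>u\<in>mat_kernel M. rat_of_int (u $ i) = q * rat_of_int (u $ j)"
  proof
    fix u assume "u \<in> mat_kernel M"
    then obtain x where x: "x \<in> carrier_vec (dim_col G)" "u = G *\<^sub>v x"
      by (rule gale_surj[OF assms(1)])
    have u: "rat_of_int (u $ k) = (\<Sum>l<dim_col G. rat_of_int (G $$ (k, l)) * rat_of_int (x $ l))"
      if "k < dim_col M" for k
      using that x dim by (simp add: scalar_prod_def atLeast0LessThan)
    show "rat_of_int (u $ i) = q * rat_of_int (u $ j)"
      using entry by (simp add: u assms sum_distrib_left mult.assoc)
  qed
next
  note dim = gale_dim_row[OF assms(1)]
  assume ratio: "\<forall>u\<in>mat_kernel M. rat_of_int (u $ i) = q * rat_of_int (u $ j)"
  show "rat_row G i = q \<cdot>\<^sub>v rat_row G j"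
  proof (intro eq_vecI)
    fix l assume "l < dim_vec (q \<cdot>\<^sub>v rat_row G j)"
    then have l: "l < dim_col G" by simp
    show "rat_row G i $ l = (q \<cdot>\<^sub>v rat_row G j) $ l"
      using ratio[rule_format, OF gale_column[OF assms(1) l]] l assms(2,3) dim by simp
  qed simp
qed

definition proportional_coords :: "int mat \<Rightarrow> nat \<Rightarrow> nat \<Rightarrow> bool" where
  "proportional_coords M i j \<longleftrightarrow> (\<exists>q. \<forall>u\<in>mat_kernel M. rat_of_int (u $ i) = q * rat_of_int (u $ j))"

lemma bouquet_edges_iff:
  assumes "gale_transform M G"
  shows "(i, j) \<in> bouquet_edges G \<longleftrightarrow> i < dim_col M \<and> j < dim_col M \<and> i \<noteq> j \<and>
    proportional_coords M i j \<and> proportional_coords M j i"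
  unfolding bouquet_edges_def proportional_coords_def mem_Collect_eq case_prod_conv gale_dim_row[OF assms]
  using rat_row_proportional_iff[OF assms, of i j] rat_row_proportional_iff[OF assms, of j i] by blast

lemma zero_row_iff:
  assumes "gale_transform M G" "i < dim_col M"
  shows "row G i = 0\<^sub>v (dim_col G) \<longleftrightarrow> (\<forall>u\<in>mat_kernel M. u $ i = 0)"
proof
  assume "row G i = 0\<^sub>v (dim_col G)"
  then show "\<forall>u\<in>mat_kernel M. u $ i = 0"
    using assms gale_dim_row[OF assms(1)] by (auto elim!: gale_surj)
next
  assume zero: "\<forall>u\<in>mat_kernel M. u $ i = 0"
  show "row G i = 0\<^sub>v (dim_col G)"
  proof (intro eq_vecI)
    fix l assume "l < dim_vec (0\<^sub>v (dim_col G) :: int vec)"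
    then have l: "l < dim_col G" by simp
    show "row G i $ l = 0\<^sub>v (dim_col G) $ l"
      using zero[rule_format, OF gale_column[OF assms(1) l]] l assms(2) gale_dim_row[OF assms(1)] by simp
  qed simp
qed

lemma proportional_coords_trans:
  assumes "proportional_coords M i j" "proportional_coords M j k"
  shows "proportional_coords M i k"
proof -
  obtain p q where "\<forall>u\<in>mat_kernel M. rat_of_int (u $ i) = p * rat_of_int (u $ j)"
    "\<forall>u\<in>mat_kernel M. rat_of_int (u $ j) = q * rat_of_int (u $ k)"
    using assms unfolding proportional_coords_def by blast
  then show ?thesis unfolding proportional_coords_def by (intro exI[of _ "p * q"]) simp
qed

lemma same_bouquet_imp_edge:
  assumes "gale_transform M G" "(i, j) \<in> (bouquet_edges G)\<^sup>*"
  shows "i = j \<or> (i, j) \<in> bouquet_edges G"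
  using assms(2)
proof (induction rule: rtrancl_induct)
  case (step j k)
  then show ?case
    using proportional_coords_trans unfolding bouquet_edges_iff[OF assms(1)] by blast
qed simp

lemma bouquet_edges_sym: "(i, j) \<in> bouquet_edges G \<Longrightarrow> (j, i) \<in> bouquet_edges G"
  unfolding bouquet_edges_def by blast

lemma bouquet_members_adjacent:
  assumes "gale_transform M G" "B \<in> bouquets G" "i \<in> B" "j \<in> B" "i \<noteq> j"
  shows "(i, j) \<in> bouquet_edges G"
proof -
  obtain k where "(k, i) \<in> (bouquet_edges G)\<^sup>*" "(k, j) \<in> (bouquet_edges G)\<^sup>*"
    using assms(2-4) unfolding bouquets_def by blast
  moreover have "sym ((bouquet_edges G)\<^sup>*)"
    by (rule sym_rtrancl) (blast intro: symI bouquet_edges_sym)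
  ultimately have "(i, j) \<in> (bouquet_edges G)\<^sup>*" by (meson rtrancl_trans symD)
  then show ?thesis using same_bouquet_imp_edge[OF assms(1)] assms(5) by blast
qed

lemma bouquet_nonempty: "B \<in> bouquets G \<Longrightarrow> B \<noteq> {}"
  unfolding bouquets_def by blast

lemma bouquet_subset:
  assumes "B \<in> bouquets G"
  shows "B \<subseteq> {..<dim_row G}"
proof -
  obtain i where i: "i < dim_row G" "B = (bouquet_edges G)\<^sup>* `` {i}"
    using assms unfolding bouquets_def by blast
  have "j < dim_row G" if "(i, j) \<in> (bouquet_edges G)\<^sup>*" for j
    using that by (induction rule: rtrancl_induct) (auto simp: i(1) bouquet_edges_def)
  then show ?thesis using i(2) by auto
qed

lemma simple_toric_no_edges:
  assumes "simple_toric M" "gale_transform M G"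
  shows "bouquet_edges G = {}"
proof -
  obtain G0 where G0: "gale_transform M G0" "\<forall>B\<in>bouquets G0. is_singleton B"
    using assms(1) unfolding simple_toric_def by blast
  have "(i, j) \<notin> bouquet_edges G0" for i j
  proof
    assume e: "(i, j) \<in> bouquet_edges G0"
    then have "i < dim_row G0" "i \<noteq> j" by (auto simp: bouquet_edges_def)
    then have "is_singleton ((bouquet_edges G0)\<^sup>* `` {i})"
      using G0(2) unfolding bouquets_def by blast
    then obtain x where "(bouquet_edges G0)\<^sup>* `` {i} = {x}" by (auto simp: is_singleton_def)
    moreover have "i \<in> (bouquet_edges G0)\<^sup>* `` {i}" "j \<in> (bouquet_edges G0)\<^sup>* `` {i}" using e by auto
    ultimately show False using \<open>i \<noteq> j\<close> by auto
  qed
  then show ?thesis using bouquet_edges_iff[OF assms(2)] bouquet_edges_iff[OF G0(1)] by auto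
qed

section \<open>From the lattice of \<open>T\<close> to the lattice of a robust ideal\<close>

lemma bouquet_vector_nonzero:
  assumes "bouquet_vector G bs c" "k \<in> set bs" "set bs \<subseteq> {..<dim_row G}"
  shows "c $ k \<noteq> 0"
proof (cases "free_bouquet G (set bs)")
  case True
  then show ?thesis using assms by (auto simp: bouquet_vector_def)
next
  case False
  then obtain l where l: "\<forall>k\<in>set bs. G $$ (k, l) \<noteq> 0"
    "c $ k = sgn (G $$ (hd bs, l)) * (G $$ (k, l) div Gcd ((\<lambda>j. G $$ (j, l)) ` set bs))"
    using assms unfolding bouquet_vector_def by auto
  have "hd bs \<in> set bs" using assms(2) by (cases bs) auto
  then have "G $$ (hd bs, l) \<noteq> 0" "G $$ (k, l) \<noteq> 0" using l(1) assms(2) by auto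
  moreover have "Gcd ((\<lambda>j. G $$ (j, l)) ` set bs) dvd G $$ (k, l)" using assms(2) by (intro Gcd_dvd) auto
  ultimately show ?thesis using l(2) by (simp add: dvd_div_eq_0_iff sgn_0_0)
qed

text \<open>In a non-mixed bouquet all the rows are positive multiples of the distinguished one, whose
  coordinate is normalised to be positive.\<close>

lemma non_mixed_bouquet_vector_nonneg:
  assumes gale: "gale_transform A G" and B: "set bs \<in> bouquets G" and vec: "bouquet_vector G bs c"
    and nm: "non_mixed_bouquet G (set bs)" and k: "k \<in> set bs"
  shows "c $ k \<ge> 0"
proof -
  have "\<not> free_bouquet G (set bs)" using nm by (simp add: non_mixed_bouquet_def)
  then obtain l where l: "l < dim_col G" "\<forall>k\<in>set bs. G $$ (k, l) \<noteq> 0"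
    "c $ k = sgn (G $$ (hd bs, l)) * (G $$ (k, l) div Gcd ((\<lambda>j. G $$ (j, l)) ` set bs))"
    using vec k unfolding bouquet_vector_def by auto
  define g where "g = Gcd ((\<lambda>j. G $$ (j, l)) ` set bs)"
  have g: "g \<ge> 0" by (simp add: g_def)
  have hd: "hd bs \<in> set bs" using k by (cases bs) auto
  have "sgn (G $$ (k, l)) = sgn (G $$ (hd bs, l))"
  proof (cases "k = hd bs")
    case False
    then have e: "(k, hd bs) \<in> bouquet_edges G"
      using bouquet_members_adjacent[OF gale B k hd] by simp
    then obtain q where q: "rat_row G k = q \<cdot>\<^sub>v rat_row G (hd bs)" and lt: "k < dim_row G" "hd bs < dim_row G"
      unfolding bouquet_edges_def by blast
    have "\<not> q < 0"
      using nm e q k hd unfolding non_mixed_bouquet_def mixed_bouquet_def by blast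
    have entry: "rat_of_int (G $$ (k, l)) = q * rat_of_int (G $$ (hd bs, l))"
      using arg_cong[OF q, of "\<lambda>x. x $ l"] l(1) lt by simp
    moreover have "G $$ (k, l) \<noteq> 0" using l(2) k by simp
    ultimately have "q > 0" using \<open>\<not> q < 0\<close> by (cases "q = 0") auto
    have "sgn (rat_of_int (G $$ (k, l))) = sgn (rat_of_int (G $$ (hd bs, l)))"
      unfolding entry using \<open>q > 0\<close> by (simp add: sgn_mult)
    then show ?thesis by (auto simp: sgn_if split: if_splits)
  qed simp
  then have c: "c $ k = sgn (G $$ (k, l)) * (G $$ (k, l) div g)" using l(3) by (simp add: g_def)
  show ?thesis
  proof (cases "g = 0")
    case False
    then have "g > 0" using g by simp
    then have "G $$ (k, l) div g \<ge> 0" if "G $$ (k, l) \<ge> 0"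
      using that by (simp add: pos_imp_zdiv_nonneg_iff)
    moreover have "G $$ (k, l) div g \<le> 0" if "G $$ (k, l) < 0"
      using that \<open>g > 0\<close> by (simp add: div_nonpos_pos_le0)
    ultimately show ?thesis unfolding c by (auto simp: sgn_if)
  qed (simp add: c)
qed

lemma distinct_concat_nth_disjoint:
  assumes "distinct (concat Bs)" "i < length Bs" "j < length Bs" "k \<in> set (Bs ! i)" "k \<in> set (Bs ! j)"
  shows "i = j"
  using assms
proof (induction Bs arbitrary: i j)
  case (Cons B Bs)
  then show ?case by (cases i; cases j) (auto simp: disjoint_iff)
qed simp

text \<open>The data exhibiting \<open>A\<close> as a \<open>T\<^sub>\<omega>\<close>-robust ideal; \<open>C\<close> is the matrix of the map \<open>D\<close>.\<close>

locale robust_presentation =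
  fixes field_type :: "'k::field itself" and T :: "int mat" and \<omega> :: "nat set" and A G :: "int mat"
    and Bs :: "nat list list" and C :: "int mat"
  assumes robust: "robust_over field_type T \<omega> A G Bs C"
begin

lemma gale: "gale_transform A G"
  and distinct_Bs: "distinct (concat Bs)"
  and set_Bs: "set ` set Bs = bouquets G"
  and C_carrier: "C \<in> carrier_mat (dim_col A) (dim_col T)"
  and length_Bs: "length Bs = dim_col T"
  and bouquet_vectors: "i < dim_col T \<Longrightarrow> bouquet_vector G (Bs ! i) (col C i)"
  and positive: "positively_graded A"
  and ideal_eq: "(toric_ideal (A * C) :: 'k mpoly set) = toric_ideal T"
  and omega: "\<omega> = {i. i < dim_col T \<and> non_mixed_bouquet G (set (Bs ! i))}"
  using robust unfolding robust_over_def bouquet_decomposition_def by auto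

lemma bouquet_nth: "i < dim_col T \<Longrightarrow> set (Bs ! i) \<in> bouquets G"
  by (simp add: set_Bs[symmetric] length_Bs)

lemma C_times_kernel:
  assumes "u \<in> mat_kernel T"
  shows "C *\<^sub>v u \<in> mat_kernel A"
proof -
  have "mat_kernel (A * C) = mat_kernel T"
    using toric_ideal_eq_imp_kernel_eq[OF ideal_eq] C_carrier by simp
  then have u: "u \<in> carrier_vec (dim_col T)" "(A * C) *\<^sub>v u = 0\<^sub>v (dim_row A)"
    using assms C_carrier by (auto simp: mat_kernel_def)
  have "A *\<^sub>v (C *\<^sub>v u) = (A * C) *\<^sub>v u"
    using u(1) C_carrier by (intro assoc_mult_mat_vec[symmetric]) auto
  then show ?thesis using u C_carrier by (auto simp: mat_kernel_def)
qed

lemma C_times_add: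
  assumes "u \<in> mat_kernel T" "v \<in> mat_kernel T"
  shows "C *\<^sub>v (u + v) = C *\<^sub>v u + C *\<^sub>v v"
  using assms C_carrier by (intro mult_add_distrib_mat_vec) (auto simp: mat_kernel_def)

lemma C_entry_zero:
  assumes "k < dim_col A" "i < dim_col T" "k \<notin> set (Bs ! i)"
  shows "C $$ (k, i) = 0"
  using bouquet_vectors[OF assms(2)] assms C_carrier gale_dim_row[OF gale]
  by (auto simp: bouquet_vector_def)

lemma C_times_index:
  assumes u: "u \<in> carrier_vec (dim_col T)" and i: "i < dim_col T" and k: "k \<in> set (Bs ! i)"
  shows "(C *\<^sub>v u) $ k = C $$ (k, i) * u $ i" and "k < dim_col A"
proof -
  show kA: "k < dim_col A"
    using bouquet_subset[OF bouquet_nth[OF i]] k gale_dim_row[OF gale] by auto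
  have "(C *\<^sub>v u) $ k = (\<Sum>j<dim_col T. C $$ (k, j) * u $ j)"
    using kA u C_carrier by (auto simp: scalar_prod_def atLeast0LessThan)
  also have "\<dots> = (\<Sum>j<dim_col T. if j = i then C $$ (k, i) * u $ i else 0)"
  proof (intro sum.cong refl)
    fix j assume j: "j \<in> {..<dim_col T}"
    have "C $$ (k, j) = 0" if "j \<noteq> i"
    proof (rule C_entry_zero[OF kA])
      show "k \<notin> set (Bs ! j)"
        using distinct_concat_nth_disjoint[OF distinct_Bs _ _ _ k, of j] that i j by (auto simp: length_Bs)
    qed (use j in simp)
    then show "C $$ (k, j) * u $ j = (if j = i then C $$ (k, i) * u $ i else 0)" by simp
  qed
  finally show "(C *\<^sub>v u) $ k = C $$ (k, i) * u $ i" using i by simp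
qed

lemma C_times_outside:
  assumes "u \<in> carrier_vec (dim_col T)" "k < dim_col A" "\<forall>i<dim_col T. k \<notin> set (Bs ! i)"
  shows "(C *\<^sub>v u) $ k = 0"
proof -
  have "(C *\<^sub>v u) $ k = (\<Sum>j<dim_col T. C $$ (k, j) * u $ j)"
    using assms C_carrier by (auto simp: scalar_prod_def atLeast0LessThan)
  then show ?thesis using C_entry_zero assms by simp
qed

lemma C_entry_nonzero:
  assumes i: "i < dim_col T" and k: "k \<in> set (Bs ! i)"
  shows "C $$ (k, i) \<noteq> 0"
proof -
  have "col C i $ k \<noteq> 0"
    using bouquet_vector_nonzero[OF bouquet_vectors[OF i] k] bouquet_subset[OF bouquet_nth[OF i]] by simp
  moreover have "k < dim_col A"
    using bouquet_subset[OF bouquet_nth[OF i]] k gale_dim_row[OF gale] by auto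
  ultimately show ?thesis using C_carrier i by simp
qed

lemma C_times_nonzero:
  assumes "u \<in> mat_kernel T" "u \<noteq> 0\<^sub>v (dim_col T)"
  shows "C *\<^sub>v u \<noteq> 0\<^sub>v (dim_col A)"
proof
  have u: "u \<in> carrier_vec (dim_col T)" using assms(1) by (rule mat_kernel_carrier_vec)
  assume zero: "C *\<^sub>v u = 0\<^sub>v (dim_col A)"
  obtain i where i: "i < dim_col T" "u $ i \<noteq> 0"
    using u assms(2) by (metis carrier_vecD eq_vecI index_zero_vec)
  obtain k where k: "k \<in> set (Bs ! i)" using bouquet_nonempty[OF bouquet_nth[OF i(1)]] by (metis ex_in_conv)
  show False
    using C_times_index[OF u i(1) k] C_entry_nonzero[OF i(1) k] i(2) zero by simp
qed

text \<open>Inside a bouquet, \<open>c\<^sub>B\<close>, the column of the Gale transform that defines it and every element of the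
  lattice are proportional to each other.\<close>

lemma bouquet_coordinates_proportional:
  assumes x: "x \<in> mat_kernel A" and i: "i < dim_col T" and k: "k \<in> set (Bs ! i)" and h: "h \<in> set (Bs ! i)"
  shows "C $$ (k, i) * x $ h = C $$ (h, i) * x $ k"
proof (cases "free_bouquet G (set (Bs ! i))")
  case True
  have "k < dim_col A" "h < dim_col A" using C_times_index(2)[OF _ i] k h zero_carrier_vec by blast+
  then have "x $ k = 0" "x $ h = 0"
    using True zero_row_iff[OF gale] x k h by (auto simp: free_bouquet_def)
  then show ?thesis by simp
next
  case False
  let ?B = "set (Bs ! i)"
  obtain l where l: "l < dim_col G" "\<forall>k\<in>?B. G $$ (k, l) \<noteq> 0"
    "\<forall>k\<in>?B. col C i $ k = sgn (G $$ (hd (Bs ! i), l)) * (G $$ (k, l) div Gcd ((\<lambda>j. G $$ (j, l)) ` ?B))"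
    using bouquet_vectors[OF i] False unfolding bouquet_vector_def by auto
  define g where "g = Gcd ((\<lambda>j. G $$ (j, l)) ` ?B)"
  define \<sigma> where "\<sigma> = sgn (G $$ (hd (Bs ! i), l))"
  have C: "g * C $$ (j, i) = \<sigma> * G $$ (j, l)" "j < dim_col A" if "j \<in> ?B" for j
  proof -
    show j: "j < dim_col A" using C_times_index(2)[OF _ i that] zero_carrier_vec by blast
    have "g dvd G $$ (j, l)" unfolding g_def using that by (intro Gcd_dvd) auto
    moreover have "C $$ (j, i) = \<sigma> * (G $$ (j, l) div g)"
      using l(3) that C_carrier i j by (auto simp: g_def \<sigma>_def)
    ultimately show "g * C $$ (j, i) = \<sigma> * G $$ (j, l)" by (auto elim!: dvdE)
  qed
  have "g \<noteq> 0"
    using l(2) k unfolding g_def by (auto simp: Gcd_0_iff)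
  have "G $$ (k, l) * x $ h = G $$ (h, l) * x $ k"
  proof (cases "k = h")
    case False
    then have "(k, h) \<in> bouquet_edges G"
      using bouquet_members_adjacent[OF gale bouquet_nth[OF i] k h] by simp
    then obtain q where q: "\<forall>u\<in>mat_kernel A. rat_of_int (u $ k) = q * rat_of_int (u $ h)"
      unfolding bouquet_edges_iff[OF gale] proportional_coords_def by blast
    have "rat_of_int (G $$ (k, l)) = q * rat_of_int (G $$ (h, l))"
      using q[rule_format, OF gale_column[OF gale l(1)]] C(2) k h l(1) gale_dim_row[OF gale] by simp
    then have "rat_of_int (G $$ (k, l) * x $ h) = rat_of_int (G $$ (h, l) * x $ k)"
      using q x by simp
    then show ?thesis by (simp only: of_int_eq_iff)
  qed simp
  then have "g * (C $$ (k, i) * x $ h) = g * (C $$ (h, i) * x $ k)"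
    using C(1)[OF k] C(1)[OF h] by (metis mult.assoc)
  then show ?thesis using \<open>g \<noteq> 0\<close> by simp
qed

text \<open>The map \<open>D\<close> is onto up to multiples, since \<open>x\<close> restricted to a bouquet is a rational multiple of
  \<open>c\<^sub>B\<close>. The factor is determined by the coordinate of a representative \<open>h\<close> of the bouquet, and \<open>N\<close> clears
  the denominators \<open>C\<^sub>h\<^sub>i\<close>.\<close>

lemma kernel_multiple_lifts:
  assumes x: "x \<in> mat_kernel A"
  obtains N u where "N \<noteq> 0" "u \<in> mat_kernel T" "C *\<^sub>v u = N \<cdot>\<^sub>v x"
proof -
  let ?s = "dim_col T"
  define h where "h i = hd (Bs ! i)" for i
  have h: "h i \<in> set (Bs ! i)" if "i < ?s" for i
    using bouquet_nonempty[OF bouquet_nth[OF that]] by (simp add: h_def)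
  define N where "N = (\<Prod>i<?s. C $$ (h i, i))"
  have N: "N \<noteq> 0" using C_entry_nonzero h by (simp add: N_def)
  define u where "u = vec ?s (\<lambda>i. (N div C $$ (h i, i)) * x $ (h i))"
  have uc: "u \<in> carrier_vec ?s" by (simp add: u_def)
  have xc: "x \<in> carrier_vec (dim_col A)" using x by (rule mat_kernel_carrier_vec)
  have Cu: "C *\<^sub>v u = N \<cdot>\<^sub>v x"
  proof (intro eq_vecI)
    fix k assume "k < dim_vec (N \<cdot>\<^sub>v x)"
    then have k: "k < dim_col A" using xc by simp
    then have "k \<in> (bouquet_edges G)\<^sup>* `` {k}" "(bouquet_edges G)\<^sup>* `` {k} \<in> bouquets G"
      using gale_dim_row[OF gale] by (auto simp: bouquets_def)
    then obtain i where i: "i < ?s" "k \<in> set (Bs ! i)"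
      using set_Bs length_Bs by (metis imageE in_set_conv_nth)
    have "C $$ (h i, i) dvd N" using i(1) unfolding N_def by (intro dvd_prodI) auto
    then obtain e where e: "N = C $$ (h i, i) * e" by (rule dvdE)
    have "(C *\<^sub>v u) $ k = e * (C $$ (k, i) * x $ h i)"
      using C_times_index(1)[OF uc i] C_entry_nonzero[OF i(1) h[OF i(1)]] i(1) by (simp add: u_def e)
    also have "\<dots> = N * x $ k"
      using bouquet_coordinates_proportional[OF x i h[OF i(1)]] by (simp add: e)
    finally show "(C *\<^sub>v u) $ k = (N \<cdot>\<^sub>v x) $ k" using k xc by simp
  qed (use xc C_carrier in simp)
  have "(A * C) *\<^sub>v u = A *\<^sub>v (C *\<^sub>v u)"
    using uc C_carrier by (intro assoc_mult_mat_vec) auto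
  also have "\<dots> = 0\<^sub>v (dim_row A)"
    using mat_kernel_smult[OF _ x, of "dim_row A" "dim_col A" N] by (simp add: Cu mat_kernel_def)
  finally have "u \<in> mat_kernel (A * C)" using uc C_carrier by (simp add: mat_kernel_def)
  then have "u \<in> mat_kernel T"
    using toric_ideal_eq_imp_kernel_eq[OF ideal_eq] C_carrier by simp
  then show thesis using that N Cu by blast
qed

text \<open>Non-mixed bouquets are non-free in \<open>A\<close>, and lifting a multiple of an element that does not vanish there
  shows that the corresponding coordinate is non-free in \<open>T\<close>.\<close>

lemma omega_nonfree:
  assumes "i \<in> \<omega>"
  shows "i < dim_col T" "\<exists>u\<in>mat_kernel T. u $ i \<noteq> 0"
proof -
  show i: "i < dim_col T" using assms omega by simp
  have "\<not> free_bouquet G (set (Bs ! i))" using assms omega by (auto simp: non_mixed_bouquet_def)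
  then obtain k where k: "k \<in> set (Bs ! i)" "row G k \<noteq> 0\<^sub>v (dim_col G)" by (auto simp: free_bouquet_def)
  have kA: "k < dim_col A" using C_times_index(2)[OF _ i k(1)] zero_carrier_vec by blast
  then obtain x where x: "x \<in> mat_kernel A" "x $ k \<noteq> 0"
    using zero_row_iff[OF gale] k by blast
  obtain N u where Nu: "N \<noteq> 0" "u \<in> mat_kernel T" "C *\<^sub>v u = N \<cdot>\<^sub>v x"
    by (rule kernel_multiple_lifts[OF x(1)])
  have "C $$ (k, i) * u $ i = N * x $ k"
    using C_times_index(1)[OF mat_kernel_carrier_vec[OF Nu(2)] i k(1)] Nu(3) kA dim_kernel[OF x(1)] by simp
  then have "u $ i \<noteq> 0" using Nu(1) x(2) by auto
  then show "\<exists>u\<in>mat_kernel T. u $ i \<noteq> 0" using Nu(2) by blast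
qed

text \<open>On a non-mixed bouquet the coordinates of \<open>C\<close> are non-negative and preserve semiconformality; on
  the others the splitting is conformal, which survives multiplication by any number.\<close>

lemma splits_lift:
  assumes "splits \<omega> T u"
  shows "splits UNIV A (C *\<^sub>v u)"
proof -
  obtain v w where vw: "v \<in> mat_kernel T" "w \<in> mat_kernel T" "v \<noteq> 0\<^sub>v (dim_col T)"
      "w \<noteq> 0\<^sub>v (dim_col T)" "u = v + w"
    and semi: "\<And>i. i < dim_col T \<Longrightarrow> \<not> (v $ i > 0 \<and> w $ i < 0) \<and> (i \<notin> \<omega> \<longrightarrow> \<not> (v $ i < 0 \<and> w $ i > 0))"
    using assms unfolding splits_def by blast
  note carr = vw(1,2)[THEN mat_kernel_carrier_vec]
  have "\<not> ((C *\<^sub>v v) $ k > 0 \<and> (C *\<^sub>v w) $ k < 0)" if k: "k < dim_col A" for k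
  proof (cases "\<exists>i<dim_col T. k \<in> set (Bs ! i)")
    case False
    then show ?thesis using C_times_outside k carr by simp
  next
    case True
    then obtain i where i: "i < dim_col T" "k \<in> set (Bs ! i)" by blast
    have "C $$ (k, i) \<ge> 0" if "i \<in> \<omega>"
    proof -
      have "col C i $ k \<ge> 0"
        using that omega non_mixed_bouquet_vector_nonneg[OF gale bouquet_nth[OF i(1)] bouquet_vectors[OF i(1)] _ i(2)]
        by auto
      then show ?thesis using C_carrier i k by simp
    qed
    then show ?thesis
      using semi[OF i(1)] C_times_index(1)[OF carr(1) i] C_times_index(1)[OF carr(2) i]
      by (auto simp: zero_less_mult_iff mult_less_0_iff)
  qed
  then show ?thesis
    unfolding splits_def vw(5) C_times_add[OF vw(1,2)]
    using vw C_times_kernel C_times_nonzero by blast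
qed

end

section \<open>A robust ideal for every admissible set\<close>

text \<open>Every variable of \<open>T\<close> is doubled: the lattice is embedded by \<open>u \<mapsto> (u, \<epsilon>u)\<close> with signs \<open>\<epsilon>\<^sub>i = 1\<close> for
  \<open>i \<in> \<omega>\<close> and \<open>\<epsilon>\<^sub>i = - 1\<close> otherwise. The two copies of \<open>i\<close> form a bouquet; if it is not
  free, it is mixed exactly for \<open>\<epsilon>\<^sub>i = - 1\<close>. For \<open>\<omega> = {}\<close> this is the Lawrence lifting.\<close>

definition copy_sign :: "nat set \<Rightarrow> nat \<Rightarrow> int" where
  "copy_sign \<omega> i = (if i \<in> \<omega> then 1 else - 1)"

definition doubling :: "nat set \<Rightarrow> nat \<Rightarrow> int mat" where
  "doubling \<omega> s = mat (s + s) s (\<lambda>(k, i). if k = i then 1 else if k = s + i then copy_sign \<omega> i else 0)"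

definition doubled_matrix :: "nat set \<Rightarrow> int mat \<Rightarrow> int mat" where
  "doubled_matrix \<omega> T = (let s = dim_col T in
     four_block_mat T (0\<^sub>m (dim_row T) s) (mat s s (\<lambda>(i, j). if i = j then - copy_sign \<omega> i else 0)) (1\<^sub>m s))"

lemma doubling_carrier: "doubling \<omega> s \<in> carrier_mat (s + s) s"
  by (simp add: doubling_def)

lemma doubled_matrix_dim: "dim_row (doubled_matrix \<omega> T) = dim_row T + dim_col T"
    "dim_col (doubled_matrix \<omega> T) = dim_col T + dim_col T"
  by (simp_all add: doubled_matrix_def Let_def)

lemma doubling_times_index:
  assumes "x \<in> carrier_vec s" "i < s"
  shows "(doubling \<omega> s *\<^sub>v x) $ i = x $ i" "(doubling \<omega> s *\<^sub>v x) $ (s + i) = copy_sign \<omega> i * x $ i"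
proof -
  have entry: "(doubling \<omega> s *\<^sub>v x) $ k =
      (\<Sum>j<s. (if k = j then 1 else if k = s + j then copy_sign \<omega> j else 0) * x $ j)" if "k < s + s" for k
    using that assms(1) by (auto simp: doubling_def scalar_prod_def atLeast0LessThan)
  have "(\<Sum>j<s. (if i = j then 1 else if i = s + j then copy_sign \<omega> j else 0) * x $ j) =
      (\<Sum>j<s. if j = i then x $ i else 0)"
    by (rule sum.cong) (use assms(2) in auto)
  then show "(doubling \<omega> s *\<^sub>v x) $ i = x $ i" using entry[of i] assms(2) by simp
  have "(\<Sum>j<s. (if s + i = j then 1 else if s + i = s + j then copy_sign \<omega> j else 0) * x $ j) =
      (\<Sum>j<s. if j = i then copy_sign \<omega> i * x $ i else 0)"
    by (rule sum.cong) auto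
  then show "(doubling \<omega> s *\<^sub>v x) $ (s + i) = copy_sign \<omega> i * x $ i" using entry[of "s + i"] assms(2) by simp
qed

lemma doubling_inj:
  assumes "x \<in> carrier_vec s" "y \<in> carrier_vec s" "doubling \<omega> s *\<^sub>v x = doubling \<omega> s *\<^sub>v y"
  shows "x = y"
proof (intro eq_vecI)
  fix i assume "i < dim_vec y"
  then have "i < s" using assms by simp
  then show "x $ i = y $ i"
    using doubling_times_index(1)[of x s i \<omega>] doubling_times_index(1)[of y s i \<omega>] assms by simp
qed (use assms in simp)

lemma doubled_matrix_kernel:
  "mat_kernel (doubled_matrix \<omega> T) = (\<lambda>x. doubling \<omega> (dim_col T) *\<^sub>v x) ` mat_kernel T"
proof -
  define s m where "s = dim_col T" and "m = dim_row T"
  define D where "D = mat s s (\<lambda>(i, j). if i = j then - copy_sign \<omega> i else 0)"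
  have T: "T \<in> carrier_mat m s" by (simp add: s_def m_def)
  have D: "D \<in> carrier_mat s s" by (simp add: D_def)
  have A: "doubled_matrix \<omega> T = four_block_mat T (0\<^sub>m m s) D (1\<^sub>m s)"
    by (simp add: doubled_matrix_def Let_def D_def s_def m_def)
  have Dx: "(D *\<^sub>v x) $ i = - copy_sign \<omega> i * x $ i" if "x \<in> carrier_vec s" "i < s" for x i
  proof -
    have "(D *\<^sub>v x) $ i = (\<Sum>j<s. (if i = j then - copy_sign \<omega> i else 0) * x $ j)"
      using that by (auto simp: D_def scalar_prod_def atLeast0LessThan)
    also have "\<dots> = (\<Sum>j<s. if j = i then - copy_sign \<omega> i * x $ i else 0)"
      by (rule sum.cong) auto
    finally show ?thesis using that by simp
  qed
  have mult: "doubled_matrix \<omega> T *\<^sub>v (x @\<^sub>v y) = (T *\<^sub>v x) @\<^sub>v (D *\<^sub>v x + y)"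
    if x: "x \<in> carrier_vec s" and y: "y \<in> carrier_vec s" for x y
  proof -
    have "doubled_matrix \<omega> T *\<^sub>v (x @\<^sub>v y) =
        (T *\<^sub>v x + 0\<^sub>m m s *\<^sub>v y) @\<^sub>v (D *\<^sub>v x + 1\<^sub>m s *\<^sub>v y)"
      unfolding A by (rule four_block_mat_mult_vec[OF T _ D _ x y]) auto
    moreover have "T *\<^sub>v x + 0\<^sub>m m s *\<^sub>v y = T *\<^sub>v x"
      using T x y by (intro eq_vecI) auto
    ultimately show ?thesis using y by simp
  qed
  have "z \<in> mat_kernel (doubled_matrix \<omega> T) \<longleftrightarrow> z \<in> (\<lambda>x. doubling \<omega> s *\<^sub>v x) ` mat_kernel T" for z
  proof -
    have iff: "x @\<^sub>v y \<in> mat_kernel (doubled_matrix \<omega> T) \<longleftrightarrow> x \<in> mat_kernel T \<and> x @\<^sub>v y = doubling \<omega> s *\<^sub>v x"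
      if x: "x \<in> carrier_vec s" and y: "y \<in> carrier_vec s" for x y
    proof -
      have zero: "0\<^sub>v (m + s) = 0\<^sub>v m @\<^sub>v (0\<^sub>v s :: int vec)" by (intro eq_vecI) auto
      have "D *\<^sub>v x + y = 0\<^sub>v s \<longleftrightarrow> x @\<^sub>v y = doubling \<omega> s *\<^sub>v x"
      proof
        assume eq: "D *\<^sub>v x + y = 0\<^sub>v s"
        have yi: "y $ i = copy_sign \<omega> i * x $ i" if "i < s" for i
          using arg_cong[OF eq, of "\<lambda>v. v $ i"] that x y D Dx[OF x that] by simp
        show "x @\<^sub>v y = doubling \<omega> s *\<^sub>v x"
        proof (intro eq_vecI)
          fix k assume "k < dim_vec (doubling \<omega> s *\<^sub>v x)"
          then have k: "k < s + s" by (simp add: doubling_def)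
          show "(x @\<^sub>v y) $ k = (doubling \<omega> s *\<^sub>v x) $ k"
          proof (cases "k < s")
            case True
            then show ?thesis using doubling_times_index(1)[OF x True] x y by simp
          next
            case False
            then show ?thesis
              using doubling_times_index(2)[OF x, of "k - s"] yi[of "k - s"] k x y by simp
          qed
        qed (use x y in \<open>simp add: doubling_def\<close>)
      next
        assume eq: "x @\<^sub>v y = doubling \<omega> s *\<^sub>v x"
        show "D *\<^sub>v x + y = 0\<^sub>v s"
        proof (intro eq_vecI)
          fix i assume "i < dim_vec (0\<^sub>v s :: int vec)"
          then have i: "i < s" by simp
          have "y $ i = (x @\<^sub>v y) $ (s + i)" using x y i by simp
          also have "\<dots> = copy_sign \<omega> i * x $ i" unfolding eq by (rule doubling_times_index(2)[OF x i])
          finally show "(D *\<^sub>v x + y) $ i = 0\<^sub>v s $ i" using Dx[OF x i] i x y D by simp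
        qed (use x y D in simp)
      qed
      then show ?thesis
        using mult[OF x y] x y T D
        by (auto simp: mat_kernel_def doubled_matrix_dim s_def[symmetric] m_def[symmetric] zero
            append_vec_eq[of _ m])
    qed
    show ?thesis
    proof
      assume z: "z \<in> mat_kernel (doubled_matrix \<omega> T)"
      then have zc: "z \<in> carrier_vec (s + s)"
        using mat_kernel_carrier_vec doubled_matrix_dim(2) unfolding s_def by metis
      have "vec_first z s @\<^sub>v vec_last z s = z" using zc by simp
      then show "z \<in> (\<lambda>x. doubling \<omega> s *\<^sub>v x) ` mat_kernel T"
        using iff[of "vec_first z s" "vec_last z s"] z by auto
    next
      assume "z \<in> (\<lambda>x. doubling \<omega> s *\<^sub>v x) ` mat_kernel T"
      then obtain x where x: "x \<in> mat_kernel T" "z = doubling \<omega> s *\<^sub>v x" by blast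
      have xc: "x \<in> carrier_vec s" using x(1) unfolding s_def by (rule mat_kernel_carrier_vec)
      have zc: "z \<in> carrier_vec (s + s)"
        unfolding x(2) by (rule mult_mat_vec_carrier[OF doubling_carrier xc])
      have "vec_first z s = x"
      proof (intro eq_vecI)
        fix i assume "i < dim_vec x"
        then show "vec_first z s $ i = x $ i"
          using doubling_times_index(1)[OF xc, of i] xc by (simp add: vec_first_def x(2))
      qed (use xc in simp)
      then have "x @\<^sub>v vec_last z s = z" using vec_first_last_append[of z s s] zc by simp
      then show "z \<in> mat_kernel (doubled_matrix \<omega> T)"
        using iff[OF xc, of "vec_last z s"] x by auto
    qed
  qed
  then show ?thesis unfolding s_def by blast
qed

text \<open>The free index of \<open>T\<close>, if any, must stay outside \<open>\<omega>\<close>: its bouquet is never non-mixed.\<close>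

locale doubled_toric =
  fixes T G :: "int mat" and \<omega> :: "nat set"
  assumes positive: "positively_graded T" and simple: "simple_toric T" and gale: "gale_transform T G"
    and admissible: "i \<in> \<omega> \<Longrightarrow> i < dim_col T \<and> (\<exists>u\<in>mat_kernel T. u $ i \<noteq> 0)"
begin

abbreviation "s \<equiv> dim_col T"
abbreviation "A \<equiv> doubled_matrix \<omega> T"
abbreviation "C \<equiv> doubling \<omega> s"
abbreviation "pairs \<equiv> map (\<lambda>i. [i, s + i]) [0..<s]"

lemma kernel_A: "mat_kernel A = (\<lambda>x. C *\<^sub>v x) ` mat_kernel T"
  by (rule doubled_matrix_kernel)

lemma gale_doubled: "gale_transform A (C * G)"
proof -
  have dims: "C \<in> carrier_mat (s + s) s" "G \<in> carrier_mat s (dim_col G)"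
    using gale_dim_row[OF gale] by (auto simp: doubling_carrier)
  have "bij_betw (\<lambda>x. G *\<^sub>v x) (carrier_vec (dim_col G)) (mat_kernel T)"
    using gale by (simp add: gale_transform_def)
  moreover have "bij_betw (\<lambda>x. C *\<^sub>v x) (mat_kernel T) (mat_kernel A)"
    unfolding bij_betw_def kernel_A
    by (auto intro!: inj_onI dest!: mat_kernel_carrier_vec intro: doubling_inj)
  ultimately have "bij_betw ((\<lambda>x. C *\<^sub>v x) \<circ> (\<lambda>x. G *\<^sub>v x)) (carrier_vec (dim_col G)) (mat_kernel A)"
    by (rule bij_betw_trans)
  then have "bij_betw (\<lambda>x. (C * G) *\<^sub>v x) (carrier_vec (dim_col G)) (mat_kernel A)"
    by (rule bij_betw_cong[THEN iffD1, rotated]) (simp add: assoc_mult_mat_vec[OF dims])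
  moreover have "dim_row (C * G) = dim_col A" by (simp add: doubling_def doubled_matrix_dim)
  ultimately show ?thesis unfolding gale_transform_def index_mult_mat(3) by blast
qed

definition original_index :: "nat \<Rightarrow> nat" where
  "original_index k = (if k < s then k else k - s)"

lemma original_index_less: "k < s + s \<Longrightarrow> original_index k < s"
  by (auto simp: original_index_def)

lemma doubled_coordinate:
  assumes "k < s + s"
  obtains \<delta> :: int where "\<delta> = 1 \<or> \<delta> = - 1"
    "\<forall>x\<in>mat_kernel T. (C *\<^sub>v x) $ k = \<delta> * x $ original_index k"
proof (cases "k < s")
  case True
  show thesis
    by (rule that[of 1]) (auto simp: original_index_def True doubling_times_index(1)[OF mat_kernel_carrier_vec])
next
  case False
  then obtain i where i: "k = s + i" "i < s" using assms by (metis add_less_cancel_left le_Suc_ex not_less)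
  show thesis
    by (rule that[of "copy_sign \<omega> i"])
       (auto simp: original_index_def i copy_sign_def doubling_times_index(2)[OF mat_kernel_carrier_vec])
qed

lemma proportional_doubled_iff:
  assumes "k < s + s" "l < s + s"
  shows "proportional_coords A k l \<longleftrightarrow> proportional_coords T (original_index k) (original_index l)"
proof -
  obtain \<delta> where d: "\<delta> = 1 \<or> \<delta> = - 1" "\<forall>x\<in>mat_kernel T. (C *\<^sub>v x) $ k = \<delta> * x $ original_index k"
    by (rule doubled_coordinate[OF assms(1)])
  obtain \<delta>' where d': "\<delta>' = 1 \<or> \<delta>' = - 1" "\<forall>x\<in>mat_kernel T. (C *\<^sub>v x) $ l = \<delta>' * x $ original_index l"
    by (rule doubled_coordinate[OF assms(2)])
  have "proportional_coords A k l \<longleftrightarrow>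
      (\<exists>q. \<forall>x\<in>mat_kernel T. rat_of_int (\<delta> * x $ original_index k) = q * rat_of_int (\<delta>' * x $ original_index l))"
    unfolding proportional_coords_def kernel_A using d(2) d'(2) by simp
  also have "\<dots> \<longleftrightarrow> proportional_coords T (original_index k) (original_index l)"
  proof
    assume "\<exists>q. \<forall>x\<in>mat_kernel T. rat_of_int (\<delta> * x $ original_index k) = q * rat_of_int (\<delta>' * x $ original_index l)"
    then obtain q where q: "\<And>x. x \<in> mat_kernel T \<Longrightarrow>
        rat_of_int (\<delta> * x $ original_index k) = q * rat_of_int (\<delta>' * x $ original_index l)" by blast
    show "proportional_coords T (original_index k) (original_index l)"
      unfolding proportional_coords_def
      by (rule exI[of _ "rat_of_int (\<delta> * \<delta>') * q"]) (use q d(1) d'(1) in fastforce)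
  next
    assume "proportional_coords T (original_index k) (original_index l)"
    then obtain q where q: "\<And>x. x \<in> mat_kernel T \<Longrightarrow>
        rat_of_int (x $ original_index k) = q * rat_of_int (x $ original_index l)"
      unfolding proportional_coords_def by blast
    show "\<exists>q. \<forall>x\<in>mat_kernel T. rat_of_int (\<delta> * x $ original_index k) = q * rat_of_int (\<delta>' * x $ original_index l)"
      by (rule exI[of _ "rat_of_int (\<delta> * \<delta>') * q"]) (use q d(1) d'(1) in fastforce)
  qed
  finally show ?thesis .
qed

text \<open>Since \<open>T\<close> is simple, only copies of the same variable have proportional coordinates.\<close>

lemma doubled_edges_iff:
  "(k, l) \<in> bouquet_edges (C * G) \<longleftrightarrow> k < s + s \<and> l < s + s \<and> k \<noteq> l \<and> original_index k = original_index l"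
proof -
  have "(original_index k, original_index l) \<notin> bouquet_edges G" using simple_toric_no_edges[OF simple gale] by simp
  moreover have "proportional_coords T i i" for i
    unfolding proportional_coords_def by (rule exI[of _ 1]) simp
  ultimately show ?thesis
    unfolding bouquet_edges_iff[OF gale_doubled] bouquet_edges_iff[OF gale] doubled_matrix_dim
    using proportional_doubled_iff[of k l] proportional_doubled_iff[of l k] original_index_less[of k] original_index_less[of l]
    by metis
qed

lemma original_index_eq_iff: "i < s \<Longrightarrow> l < s + s \<and> original_index l = i \<longleftrightarrow> l \<in> {i, s + i}"
  by (auto simp: original_index_def)

lemma doubled_bouquet:
  assumes "k < s + s"
  shows "(bouquet_edges (C * G))\<^sup>* `` {k} = {original_index k, s + original_index k}"
proof -
  have "l \<in> (bouquet_edges (C * G))\<^sup>* `` {k} \<longleftrightarrow> l < s + s \<and> original_index l = original_index k" for l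
  proof
    assume "l \<in> (bouquet_edges (C * G))\<^sup>* `` {k}"
    then have "k = l \<or> (k, l) \<in> bouquet_edges (C * G)"
      using same_bouquet_imp_edge[OF gale_doubled] by simp
    then show "l < s + s \<and> original_index l = original_index k" using assms by (auto simp: doubled_edges_iff)
  next
    assume "l < s + s \<and> original_index l = original_index k"
    then have "k = l \<or> (k, l) \<in> bouquet_edges (C * G)" using assms by (auto simp: doubled_edges_iff)
    then show "l \<in> (bouquet_edges (C * G))\<^sup>* `` {k}" by auto
  qed
  then show ?thesis using original_index_eq_iff[OF original_index_less[OF assms]] by blast
qed

lemma doubled_bouquets: "bouquets (C * G) = set ` set pairs"
proof -
  have "bouquets (C * G) = {{original_index k, s + original_index k} | k. k < s + s}"
    unfolding bouquets_def using doubled_bouquet doubling_carrier[of \<omega> s] by auto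
  also have "\<dots> = (\<lambda>i. {i, s + i}) ` {..<s}"
  proof (intro equalityI subsetI)
    fix B assume "B \<in> {{original_index k, s + original_index k} | k. k < s + s}"
    then show "B \<in> (\<lambda>i. {i, s + i}) ` {..<s}" using original_index_less by auto
  next
    fix B assume "B \<in> (\<lambda>i. {i, s + i}) ` {..<s}"
    then obtain i where "i < s" "B = {i, s + i}" by auto
    then show "B \<in> {{original_index k, s + original_index k} | k. k < s + s}"
      by (intro CollectI exI[of _ i]) (simp add: original_index_def)
  qed
  also have "\<dots> = set ` set pairs" by (simp add: image_image lessThan_atLeast0)
  finally show ?thesis .
qed

lemma distinct_pairs: "distinct (concat pairs)"
proof -
  have "distinct (concat (map (\<lambda>i. [i, s + i]) [0..<n])) \<and>
      set (concat (map (\<lambda>i. [i, s + i]) [0..<n])) = {..<n} \<union> {s..<s + n}" if "n \<le> s" for n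
    using that by (induction n) auto
  then show ?thesis by blast
qed

lemma doubled_gale_entry:
  assumes "i < s" "l < dim_col G"
  shows "(C * G) $$ (i, l) = G $$ (i, l)" "(C * G) $$ (s + i, l) = copy_sign \<omega> i * G $$ (i, l)"
proof -
  have dims: "dim_row C = s + s" "dim_row G = s"
    using gale_dim_row[OF gale] by (auto simp: doubling_def)
  have c: "col G l \<in> carrier_vec s" by (rule carrier_vecI) (simp add: dims)
  have "(C * G) $$ (k, l) = (C *\<^sub>v col G l) $ k" if "k < s + s" for k
    using that dims assms by simp
  then show "(C * G) $$ (i, l) = G $$ (i, l)" "(C * G) $$ (s + i, l) = copy_sign \<omega> i * G $$ (i, l)"
    using doubling_times_index[OF c assms(1), of \<omega>] assms dims by simp_all
qed

lemma free_doubled_iff: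
  assumes "i < s"
  shows "free_bouquet (C * G) {i, s + i} \<longleftrightarrow> (\<forall>u\<in>mat_kernel T. u $ i = 0)"
proof -
  have "free_bouquet (C * G) {i, s + i} \<longleftrightarrow>
      (\<forall>u\<in>mat_kernel T. (C *\<^sub>v u) $ i = 0) \<and> (\<forall>u\<in>mat_kernel T. (C *\<^sub>v u) $ (s + i) = 0)"
    using assms zero_row_iff[OF gale_doubled, of i] zero_row_iff[OF gale_doubled, of "s + i"]
    by (simp add: free_bouquet_def kernel_A doubled_matrix_dim)
  also have "\<dots> \<longleftrightarrow> (\<forall>u\<in>mat_kernel T. u $ i = 0)"
    using doubling_times_index[OF mat_kernel_carrier_vec assms] by (auto simp: copy_sign_def)
  finally show ?thesis .
qed

text \<open>For \<open>\<epsilon>\<^sub>i = 1\<close> the two rows agree, so a negative ratio would force them to vanish; for \<open>\<epsilon>\<^sub>i = - 1\<close> their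
  ratio is \<open>- 1\<close>.\<close>

lemma non_mixed_doubled_iff:
  assumes i: "i < s"
  shows "non_mixed_bouquet (C * G) {i, s + i} \<longleftrightarrow> i \<in> \<omega>"
proof (cases "\<forall>u\<in>mat_kernel T. u $ i = 0")
  case True
  then show ?thesis using admissible free_doubled_iff[OF i] by (auto simp: non_mixed_bouquet_def)
next
  case False
  then have nfree: "\<not> free_bouquet (C * G) {i, s + i}" using free_doubled_iff[OF i] by blast
  have ratio: "rat_row (C * G) k = q \<cdot>\<^sub>v rat_row (C * G) l \<longleftrightarrow>
      (\<forall>u\<in>mat_kernel T. rat_of_int ((C *\<^sub>v u) $ k) = q * rat_of_int ((C *\<^sub>v u) $ l))"
    if "k < s + s" "l < s + s" for k l q
    using rat_row_proportional_iff[OF gale_doubled, of k l q] that by (simp add: kernel_A doubled_matrix_dim)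
  note coords = doubling_times_index[OF mat_kernel_carrier_vec i, of _ \<omega>]
  have edges: "(i, s + i) \<in> bouquet_edges (C * G)" "(s + i, i) \<in> bouquet_edges (C * G)"
    using i by (auto simp: doubled_edges_iff original_index_def)
  have "mixed_bouquet (C * G) {i, s + i} \<longleftrightarrow> i \<notin> \<omega>"
  proof
    assume "mixed_bouquet (C * G) {i, s + i}"
    then obtain k l q where kl: "k \<in> {i, s + i}" "l \<in> {i, s + i}" "q < 0"
        "rat_row (C * G) k = q \<cdot>\<^sub>v rat_row (C * G) l"
      unfolding mixed_bouquet_def by blast
    show "i \<notin> \<omega>"
    proof
      assume "i \<in> \<omega>"
      then have same: "(C *\<^sub>v u) $ k = u $ i" "(C *\<^sub>v u) $ l = u $ i" if "u \<in> mat_kernel T" for u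
        using kl(1,2) coords[OF that] by (auto simp: copy_sign_def)
      have "k < s + s" "l < s + s" using kl(1,2) i by auto
      then have "\<forall>u\<in>mat_kernel T. rat_of_int ((C *\<^sub>v u) $ k) = q * rat_of_int ((C *\<^sub>v u) $ l)"
        using ratio kl(4) by blast
      then have "rat_of_int (u $ i) = q * rat_of_int (u $ i)" if "u \<in> mat_kernel T" for u
        using that same[OF that] by metis
      then have "u $ i = 0" if "u \<in> mat_kernel T" for u
        using that kl(3) by (metis mult_cancel_right1 of_int_eq_0_iff not_one_less_zero)
      then show False using False by blast
    qed
  next
    assume "i \<notin> \<omega>"
    then have "rat_row (C * G) i = (- 1) \<cdot>\<^sub>v rat_row (C * G) (s + i)"
      using ratio[of i "s + i" "- 1"] coords i by (simp add: copy_sign_def)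
    moreover have "(- 1 :: rat) < 0" by simp
    ultimately show "mixed_bouquet (C * G) {i, s + i}"
      using nfree edges(1) unfolding mixed_bouquet_def by blast
  qed
  then show ?thesis using nfree by (auto simp: non_mixed_bouquet_def)
qed

text \<open>The entries of the two rows in any column are \<open>a\<close> and \<open>\<epsilon>\<^sub>i a\<close>, with greatest common divisor \<open>\<bar>a\<bar>\<close>, so
  normalising by it and by the sign of \<open>a\<close> leaves \<open>1\<close> and \<open>\<epsilon>\<^sub>i\<close>.\<close>

lemma bouquet_vector_doubled:
  assumes i: "i < s"
  shows "bouquet_vector (C * G) [i, s + i] (col C i)"
proof -
  have dims: "dim_row (C * G) = s + s" "dim_col (C * G) = dim_col G"
    using doubling_carrier[of \<omega> s] by auto
  have entries: "col C i $ i = 1" "col C i $ (s + i) = copy_sign \<omega> i"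
    "\<And>k. k < s + s \<Longrightarrow> k \<notin> {i, s + i} \<Longrightarrow> col C i $ k = 0"
    using i by (auto simp: doubling_def)
  have cs: "copy_sign \<omega> i = 1 \<or> copy_sign \<omega> i = - 1" by (simp add: copy_sign_def)
  have cc: "col C i \<in> carrier_vec (s + s)" by (rule carrier_vecI) (simp add: doubling_def)
  show ?thesis
  proof (cases "free_bouquet (C * G) {i, s + i}")
    case True
    then show ?thesis using entries cs cc unfolding bouquet_vector_def dims by auto
  next
    case False
    then have "\<not> (\<forall>u\<in>mat_kernel T. u $ i = 0)" using free_doubled_iff[OF i] by simp
    then have row: "row G i \<noteq> 0\<^sub>v (dim_col G)" using zero_row_iff[OF gale i] by simp
    have "\<exists>l<dim_col G. G $$ (i, l) \<noteq> 0"
    proof (rule ccontr)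
      assume "\<not> (\<exists>l<dim_col G. G $$ (i, l) \<noteq> 0)"
      then have "row G i = 0\<^sub>v (dim_col G)" using i gale_dim_row[OF gale] by (intro eq_vecI) auto
      then show False using row by simp
    qed
    then obtain l where l: "l < dim_col G" "G $$ (i, l) \<noteq> 0" by blast
    define a where "a = G $$ (i, l)"
    have G: "(C * G) $$ (i, l) = a" "(C * G) $$ (s + i, l) = copy_sign \<omega> i * a"
      using doubled_gale_entry[OF i l(1)] by (simp_all add: a_def)
    have a: "a \<noteq> 0" using l(2) by (simp add: a_def)
    have gcd: "Gcd ((\<lambda>j. (C * G) $$ (j, l)) ` {i, s + i}) = \<bar>a\<bar>"
      using cs by (auto simp: G)
    have unit: "sgn a * (a div \<bar>a\<bar>) = 1" "sgn a * (- a div \<bar>a\<bar>) = - 1"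
    proof -
      have "a div \<bar>a\<bar> = sgn a" "- a div \<bar>a\<bar> = - sgn a"
        using a nonzero_mult_div_cancel_right[of "\<bar>a\<bar>" "sgn a"]
          nonzero_mult_div_cancel_right[of "\<bar>a\<bar>" "- sgn a"] sgn_mult_abs[of a] by simp_all
      then show "sgn a * (a div \<bar>a\<bar>) = 1" "sgn a * (- a div \<bar>a\<bar>) = - 1"
        using a by (simp_all add: sgn_if)
    qed
    have "\<forall>k\<in>{i, s + i}. (C * G) $$ (k, l) \<noteq> 0" using a cs by (auto simp: G)
    moreover have "\<forall>k\<in>{i, s + i}. col C i $ k = sgn ((C * G) $$ (i, l)) *
        ((C * G) $$ (k, l) div Gcd ((\<lambda>j. (C * G) $$ (j, l)) ` {i, s + i}))"
      unfolding gcd using entries cs unit by (auto simp: G)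
    ultimately show ?thesis
      using False entries cc l(1) unfolding bouquet_vector_def dims by auto
  qed
qed

lemma positive_doubled: "positively_graded A"
proof -
  have "z = 0\<^sub>v (s + s)" if z: "z \<in> mat_kernel A" "\<forall>i<s + s. z $ i \<ge> 0" for z
  proof -
    obtain x where x: "x \<in> mat_kernel T" "z = C *\<^sub>v x" using z(1) unfolding kernel_A by blast
    have xc: "x \<in> carrier_vec s" using x(1) by (rule mat_kernel_carrier_vec)
    have "\<forall>i<s. x $ i \<ge> 0"
      using z(2) unfolding x(2) by (metis doubling_times_index(1)[OF xc] trans_less_add1)
    then have "x = 0\<^sub>v s" by (rule nonneg_kernel_element_eq_zero[OF positive x(1)])
    then show ?thesis using x(2) doubling_carrier[of \<omega> s] by (auto intro!: eq_vecI)
  qed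
  moreover have "0\<^sub>v (s + s) \<in> mat_kernel A"
    using zero_in_mat_kernel[of A] unfolding doubled_matrix_dim .
  moreover have "\<forall>i<s + s. (0\<^sub>v (s + s) :: int vec) $ i \<ge> 0" by simp
  ultimately show ?thesis
    unfolding positively_graded_def doubled_matrix_dim by blast
qed

lemma kernel_AC: "mat_kernel (A * C) = mat_kernel T"
proof -
  have dims: "A \<in> carrier_mat (dim_row A) (s + s)" "C \<in> carrier_mat (s + s) s"
    by (auto simp: doubling_carrier doubled_matrix_dim)
  have "x \<in> mat_kernel (A * C) \<longleftrightarrow> x \<in> mat_kernel T" if x: "x \<in> carrier_vec s" for x
  proof -
    have "x \<in> mat_kernel (A * C) \<longleftrightarrow> C *\<^sub>v x \<in> mat_kernel A"
    proof -
      have "C *\<^sub>v x \<in> carrier_vec (dim_col A)" "dim_col C = s"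
        using mult_mat_vec_carrier[OF dims(2) x] by (simp_all add: doubled_matrix_dim doubling_def)
      then show ?thesis
        using x by (simp add: mat_kernel_def assoc_mult_mat_vec[OF dims x])
    qed
    also have "\<dots> \<longleftrightarrow> x \<in> mat_kernel T"
      unfolding kernel_A using doubling_inj[OF x] mat_kernel_carrier_vec by (auto simp: image_iff)
    finally show ?thesis .
  qed
  moreover have "mat_kernel (A * C) \<subseteq> carrier_vec s" "mat_kernel T \<subseteq> carrier_vec s"
    by (auto simp: mat_kernel_def carrier_matD(2)[OF doubling_carrier])
  ultimately show ?thesis by blast
qed

lemma robust_doubled: "robust_over TYPE('k::field) T \<omega> A (C * G) pairs C"
proof -
  have "bouquet_decomposition A (C * G) pairs C"
    unfolding bouquet_decomposition_def
    using gale_doubled distinct_pairs doubled_bouquets doubling_carrier bouquet_vector_doubled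
    by (simp add: doubled_matrix_dim)
  moreover have "(toric_ideal (A * C) :: 'k mpoly set) = toric_ideal T"
    by (rule kernel_eq_imp_toric_ideal_eq[OF kernel_AC]) (use doubling_carrier[of \<omega> s] in simp)
  moreover have "\<omega> = {i. i < s \<and> non_mixed_bouquet (C * G) (set (pairs ! i))}"
    using non_mixed_doubled_iff admissible by auto
  ultimately show ?thesis
    unfolding robust_over_def using positive_doubled by simp
qed

text \<open>Where \<open>\<epsilon>\<^sub>i = - 1\<close>, semiconformality at the two copies of \<open>i\<close> amounts to conformality at \<open>i\<close>.\<close>

lemma splits_descend:
  assumes u: "u \<in> mat_kernel T" and split: "splits UNIV A (C *\<^sub>v u)"
  shows "splits \<omega> T u"
proof -
  obtain v' w' where vw': "v' \<in> mat_kernel A" "w' \<in> mat_kernel A" "v' \<noteq> 0\<^sub>v (s + s)"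
      "w' \<noteq> 0\<^sub>v (s + s)" "C *\<^sub>v u = v' + w'"
    and semi: "\<And>k. k < s + s \<Longrightarrow> \<not> (v' $ k > 0 \<and> w' $ k < 0)"
    using split unfolding splits_def doubled_matrix_dim by blast
  obtain v w where vw: "v \<in> mat_kernel T" "v' = C *\<^sub>v v" "w \<in> mat_kernel T" "w' = C *\<^sub>v w"
    using vw'(1,2) unfolding kernel_A by blast
  have carr: "u \<in> carrier_vec s" "v \<in> carrier_vec s" "w \<in> carrier_vec s"
    using u vw mat_kernel_carrier_vec by auto
  have "C *\<^sub>v (v + w) = C *\<^sub>v v + C *\<^sub>v w"
    using doubling_carrier[of \<omega> s] carr by (intro mult_add_distrib_mat_vec) auto
  then have "C *\<^sub>v u = C *\<^sub>v (v + w)" using vw'(5) vw by simp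
  then have uvw: "u = v + w" using doubling_inj[OF carr(1)] carr by auto
  have zero: "C *\<^sub>v 0\<^sub>v s = 0\<^sub>v (s + s)" using doubling_carrier[of \<omega> s] by (auto intro!: eq_vecI)
  have "v \<noteq> 0\<^sub>v s" "w \<noteq> 0\<^sub>v s" using vw'(3,4) vw zero by auto
  moreover have "\<not> (v $ i > 0 \<and> w $ i < 0) \<and> (i \<notin> \<omega> \<longrightarrow> \<not> (v $ i < 0 \<and> w $ i > 0))" if i: "i < s" for i
    using semi[of i] semi[of "s + i"] i doubling_times_index[OF carr(2) i, of \<omega>]
      doubling_times_index[OF carr(3) i, of \<omega>]
    by (auto simp: vw copy_sign_def)
  ultimately show ?thesis unfolding splits_def using vw(1,3) uvw by blast
qed

lemma indispensable_doubled:
  assumes u: "u \<in> mat_kernel T" "u \<noteq> 0\<^sub>v s" and nsplit: "\<not> splits \<omega> T u"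
  shows "C *\<^sub>v u \<in> indispensable TYPE('k::field) A"
proof (rule not_splits_imp_indispensable)
  show "C *\<^sub>v u \<in> mat_kernel A" using u(1) unfolding kernel_A by blast
  show "C *\<^sub>v u \<noteq> 0\<^sub>v (dim_col A)"
  proof
    assume "C *\<^sub>v u = 0\<^sub>v (dim_col A)"
    moreover have "C *\<^sub>v 0\<^sub>v s = 0\<^sub>v (s + s)" using doubling_carrier[of \<omega> s] by (auto intro!: eq_vecI)
    ultimately have "u = 0\<^sub>v s"
      using doubling_inj[OF mat_kernel_carrier_vec[OF u(1)], of "0\<^sub>v s" \<omega>] by (simp add: doubled_matrix_dim)
    then show False using u(2) by simp
  qed
  show "\<not> splits UNIV A (C *\<^sub>v u)" using splits_descend[OF u(1)] nsplit by blast
qed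

end

section \<open>The strongly robustness complex\<close>

text \<open>Whichever robust ideal witnesses that \<open>u\<close> belongs to \<open>S\<^sub>\<omega>(T)\<close>, a splitting of \<open>u\<close> would lift to its
  lattice.\<close>

lemma S_omega_not_splits:
  assumes "u \<in> S_omega TYPE('k::field) T \<omega>"
  shows "\<not> splits \<omega> T u"
proof
  assume "splits \<omega> T u"
  obtain A G Bs C where "robust_over TYPE('k) T \<omega> A G Bs C" "C *\<^sub>v u \<in> indispensable TYPE('k) A"
    using assms unfolding S_omega_def by blast
  then interpret robust_presentation "TYPE('k)" T \<omega> A G Bs C by unfold_locales
  show False
    using splits_imp_not_indispensable[OF positive splits_lift[OF \<open>splits \<omega> T u\<close>], where 'k='k]
      \<open>C *\<^sub>v u \<in> indispensable TYPE('k) A\<close> by blast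
qed

text \<open>Existence of a robust ideal keeps the index of the free bouquet out of \<open>\<omega>\<close>.\<close>

lemma S_omega_admissible:
  assumes "u \<in> S_omega TYPE('k::field) T \<omega>" "i \<in> \<omega>"
  shows "i < dim_col T \<and> (\<exists>u\<in>mat_kernel T. u $ i \<noteq> 0)"
proof -
  obtain A G Bs C where "robust_over TYPE('k) T \<omega> A G Bs C"
    using assms(1) unfolding S_omega_def by blast
  then interpret robust_presentation "TYPE('k)" T \<omega> A G Bs C by unfold_locales
  show ?thesis using omega_nonfree[OF assms(2)] by blast
qed

text \<open>The right-hand side mentions no robust ideal, so the choice of one does not matter.\<close>

lemma S_omega_eq:
  assumes "positively_graded T" "simple_toric T" "gale_transform T G"
    and "\<And>i. i \<in> \<omega> \<Longrightarrow> i < dim_col T \<and> (\<exists>u\<in>mat_kernel T. u $ i \<noteq> 0)"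
  shows "S_omega TYPE('k::field) T \<omega> = {u \<in> graver TYPE('k) T. \<not> splits \<omega> T u}"
proof -
  interpret doubled_toric T G \<omega> using assms by unfold_locales
  show ?thesis
  proof (intro equalityI subsetI)
    fix u assume "u \<in> S_omega TYPE('k) T \<omega>"
    then show "u \<in> {u \<in> graver TYPE('k) T. \<not> splits \<omega> T u}"
      using S_omega_not_splits[of u T \<omega>, where 'k='k] unfolding S_omega_def by blast
  next
    fix u assume u: "u \<in> {u \<in> graver TYPE('k) T. \<not> splits \<omega> T u}"
    then have "C *\<^sub>v u \<in> indispensable TYPE('k) A"
      using indispensable_doubled by (auto simp: graver_iff)
    then show "u \<in> S_omega TYPE('k) T \<omega>"
      using u robust_doubled[where 'k='k] unfolding S_omega_def by blast
  qed
qed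

text \<open>Shrinking \<open>\<omega>\<close> leaves fewer splittings. If there is no Graver element at all, every set is a face.\<close>

lemma robustness_complex_simplicial:
  assumes T: "positively_graded T" "simple_toric T" "gale_transform T G"
  shows "abstract_simplicial_complex (robustness_complex TYPE('k::field) T)"
  unfolding abstract_simplicial_complex_def
proof (intro conjI ballI allI impI)
  have "S_omega TYPE('k) T {} = graver TYPE('k) T"
    using S_omega_eq[OF T, of "{}", where 'k='k] graver_not_splits[where 'k='k] by blast
  then show "{} \<in> robustness_complex TYPE('k) T" by (simp add: robustness_complex_def)
next
  fix \<sigma> assume "\<sigma> \<in> robustness_complex TYPE('k) T"
  then have \<sigma>: "\<sigma> \<subseteq> {..<dim_col T}" "S_omega TYPE('k) T \<sigma> = graver TYPE('k) T"
    by (auto simp: robustness_complex_def)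
  show "finite \<sigma>" using \<sigma>(1) finite_subset by blast
  fix \<tau> assume "\<tau> \<subseteq> \<sigma>"
  have "S_omega TYPE('k) T \<tau> = graver TYPE('k) T"
  proof (cases "graver TYPE('k) T = {}")
    case True
    then show ?thesis by (simp add: S_omega_def)
  next
    case False
    then obtain u where "u \<in> S_omega TYPE('k) T \<sigma>" using \<sigma>(2) by blast
    then have "i < dim_col T \<and> (\<exists>u\<in>mat_kernel T. u $ i \<noteq> 0)" if "i \<in> \<tau>" for i
      using S_omega_admissible[of u T \<sigma> i, where 'k='k] \<open>\<tau> \<subseteq> \<sigma>\<close> that by blast
    then have "S_omega TYPE('k) T \<tau> = {u \<in> graver TYPE('k) T. \<not> splits \<tau> T u}"
      by (rule S_omega_eq[OF T])
    moreover have "\<not> splits \<sigma> T u" if "u \<in> graver TYPE('k) T" for u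
      using that \<sigma>(2) S_omega_not_splits[of u T \<sigma>, where 'k='k] by blast
    ultimately show ?thesis using splits_mono[OF _ \<open>\<tau> \<subseteq> \<sigma>\<close>] by blast
  qed
  then show "\<tau> \<in> robustness_complex TYPE('k) T"
    using \<sigma>(1) \<open>\<tau> \<subseteq> \<sigma>\<close> by (auto simp: robustness_complex_def)
qed

section \<open>The rank of a lattice\<close>

text \<open>The residue classes modulo 2 of the coordinate vectors count a lattice modulo its double, which
  bounds the number of elements of one basis by that of another.\<close>

lemma gale_dim_le:
  assumes G: "gale_transform M G" and G': "gale_transform M G'"
  shows "dim_col G \<le> dim_col G'"
proof -
  let ?d = "dim_col G" and ?d' = "dim_col G'"
  define x :: "nat set \<Rightarrow> int vec" where "x S = vec ?d (\<lambda>i. if i \<in> S then 1 else 0)" for S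
  have xc: "x S \<in> carrier_vec ?d" for S by (simp add: x_def)
  have "\<exists>y. y \<in> carrier_vec ?d' \<and> G *\<^sub>v x S = G' *\<^sub>v y" for S
    using gale_surj[OF G' gale_in_kernel[OF G xc]] by blast
  then obtain y where y: "\<And>S. y S \<in> carrier_vec ?d'" "\<And>S. G *\<^sub>v x S = G' *\<^sub>v y S" by metis
  define parity where "parity S = {j. j < ?d' \<and> odd (y S $ j)}" for S
  have Gc: "G \<in> carrier_mat (dim_row G) ?d" "G' \<in> carrier_mat (dim_row G') ?d'" by auto
  have mult_smult: "H *\<^sub>v (k \<cdot>\<^sub>v v) = k \<cdot>\<^sub>v (H *\<^sub>v v)" if "v \<in> carrier_vec (dim_col H)"
    for H :: "int mat" and k v
    using that by (intro eq_vecI) auto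
  have "inj_on parity (Pow {..<?d})"
  proof (rule inj_onI)
    fix S S' assume S: "S \<in> Pow {..<?d}" "S' \<in> Pow {..<?d}" and eq: "parity S = parity S'"
    have even: "even (y S $ j - y S' $ j)" if "j < ?d'" for j
      using eq that unfolding parity_def by auto
    define z where "z = vec ?d' (\<lambda>j. (y S $ j - y S' $ j) div 2)"
    have zc: "z \<in> carrier_vec ?d'" by (simp add: z_def)
    have yz: "y S - y S' = 2 \<cdot>\<^sub>v z"
      using y(1)[of S] y(1)[of S'] even by (intro eq_vecI) (auto simp: z_def)
    obtain t where t: "t \<in> carrier_vec ?d" "G' *\<^sub>v z = G *\<^sub>v t"
      using gale_surj[OF G gale_in_kernel[OF G' zc]] by blast
    have "G *\<^sub>v (x S - x S') = G *\<^sub>v x S - G *\<^sub>v x S'"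
      by (rule mult_minus_distrib_mat_vec[OF Gc(1) xc xc])
    also have "\<dots> = G' *\<^sub>v (y S - y S')"
      unfolding y(2) by (rule mult_minus_distrib_mat_vec[OF Gc(2) y(1) y(1), symmetric])
    also have "\<dots> = 2 \<cdot>\<^sub>v (G *\<^sub>v t)"
      unfolding yz t(2)[symmetric] by (rule mult_smult[OF zc])
    also have "\<dots> = G *\<^sub>v (2 \<cdot>\<^sub>v t)"
      by (rule mult_smult[OF t(1), symmetric])
    finally have xt: "x S - x S' = 2 \<cdot>\<^sub>v t"
      using gale_inj[OF G, of "x S - x S'" "2 \<cdot>\<^sub>v t"] xc t(1) by simp
    have "i \<in> S \<longleftrightarrow> i \<in> S'" if "i < ?d" for i
    proof -
      have "(if i \<in> S then 1 else 0) - (if i \<in> S' then 1 else 0) = 2 * t $ i"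
        using arg_cong[OF xt, of "\<lambda>v. v $ i"] that t(1) by (simp add: x_def)
      then show ?thesis by (auto split: if_splits) presburger+
    qed
    then show "S = S'" using S by blast
  qed
  moreover have "parity ` Pow {..<?d} \<subseteq> Pow {..<?d'}" by (auto simp: parity_def)
  ultimately have "card (Pow {..<?d}) \<le> card (Pow {..<?d'})"
    by (intro card_inj_on_le) auto
  then show ?thesis by (simp add: card_Pow)
qed

lemma codimension_eq:
  assumes "gale_transform M G"
  shows "codimension M = dim_col G"
  unfolding codimension_def
proof (rule the_equality)
  show "\<exists>G'. gale_transform M G' \<and> dim_col G' = dim_col G" using assms by blast
  fix k assume "\<exists>G'. gale_transform M G' \<and> dim_col G' = k"
  then show "k = dim_col G" using gale_dim_le[OF assms] gale_dim_le[OF _ assms] by (auto intro: antisym)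
qed

section \<open>Lattice points of the Gale polygon\<close>

definition row_value :: "int mat \<Rightarrow> nat \<Rightarrow> int \<Rightarrow> int \<Rightarrow> int" where
  "row_value G k x y = G $$ (k, 0) * x + G $$ (k, 1) * y"

definition plane_vec :: "int \<Rightarrow> int \<Rightarrow> int vec" where
  "plane_vec x y = vec 2 (\<lambda>l. if l = 0 then x else y)"

lemma row_value_combination:
  "row_value G k (p * x + q * x') (p * y + q * y') = p * row_value G k x y + q * row_value G k x' y'"
  by (simp add: row_value_def algebra_simps)

lemma plane_vec_carrier: "plane_vec x y \<in> carrier_vec 2"
  by (simp add: plane_vec_def)

lemma carrier_vec_2_eq:
  assumes "v \<in> carrier_vec 2"
  shows "v = plane_vec (v $ 0) (v $ 1)"
  using assms by (intro eq_vecI) (auto simp: plane_vec_def less_2_cases_iff)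

lemma mult_plane_vec_index:
  assumes "dim_col G = 2" "k < dim_row G"
  shows "(G *\<^sub>v plane_vec x y) $ k = row_value G k x y"
proof -
  have "(G *\<^sub>v plane_vec x y) $ k = (\<Sum>l<2. G $$ (k, l) * plane_vec x y $ l)"
    using assms by (auto simp: scalar_prod_def atLeast0LessThan plane_vec_def)
  also have "\<dots> = row_value G k x y"
    by (simp add: numeral_2_eq_2 plane_vec_def row_value_def)
  finally show ?thesis .
qed

lemma gale_polygon_convex: "convex (gale_polygon G)"
  by (simp add: gale_polygon_def)

lemma reduced_point_in_polygon:
  assumes "k < dim_row G"
  shows "reduced_gale_point G k \<in> gale_polygon G" "- reduced_gale_point G k \<in> gale_polygon G"
  unfolding gale_polygon_def using assms by (intro hull_inc UN_I[of k]; simp)+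

lemma zero_in_polygon:
  assumes "k < dim_row G"
  shows "0 \<in> gale_polygon G"
proof -
  have "(1 / 2) *\<^sub>R reduced_gale_point G k + (1 / 2) *\<^sub>R (- reduced_gale_point G k) \<in> gale_polygon G"
    using convexD[OF gale_polygon_convex reduced_point_in_polygon[OF assms], of "1 / 2" "1 / 2"] by simp
  then show ?thesis by simp
qed

lemma convex_zero_combination:
  fixes p q :: "'a::real_vector"
  assumes "convex P" "0 \<in> P" "p \<in> P" "q \<in> P" "u \<ge> 0" "v \<ge> 0" "u + v \<le> (1::real)"
  shows "u *\<^sub>R p + v *\<^sub>R q \<in> P"
proof -
  have "u *\<^sub>R p + v *\<^sub>R q = u *\<^sub>R p + v *\<^sub>R q + (1 - u - v) *\<^sub>R 0" by simp
  then have "u *\<^sub>R p + v *\<^sub>R q \<in> convex hull {p, q, 0}"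
    unfolding convex_hull_3 mem_Collect_eq using assms(5-7)
    by (intro exI[of _ u] exI[of _ v] exI[of _ "1 - u - v"]) auto
  moreover have "convex hull {p, q, 0} \<subseteq> P" using assms(1-4) by (intro hull_minimal) auto
  ultimately show ?thesis by blast
qed

lemma reduced_gale_row:
  assumes "G $$ (k, 0) \<noteq> 0 \<or> G $$ (k, 1) \<noteq> 0"
  obtains g r1 r2 where "g > 0" "reduced_gale G k = (r1, r2)" "coprime r1 r2"
    "G $$ (k, 0) = g * r2" "G $$ (k, 1) = - g * r1"
proof -
  define a b where "a = G $$ (k, 0)" and "b = G $$ (k, 1)"
  define g where "g = gcd a b"
  have ab: "a \<noteq> 0 \<or> b \<noteq> 0" using assms by (simp add: a_def b_def)
  then have g: "g > 0" by (simp add: g_def)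
  have "reduced_gale G k = (- (b div g), a div g)"
    using ab by (auto simp: reduced_gale_def Let_def a_def b_def g_def)
  moreover have "coprime (- (b div g)) (a div g)"
    using div_gcd_coprime[of a b] ab by (simp add: g_def coprime_commute)
  moreover have "a = g * (a div g)" "b = - g * - (b div g)"
    by (simp_all add: g_def)
  ultimately show thesis using that g unfolding a_def b_def by blast
qed

text \<open>The lattice points \<open>N\<cdot>e + f\<close> form the line next to the line of \<open>e\<close>. The first of them that lies
  weakly on the side of \<open>e\<close> of all lines \<open>\<langle>t\<^sub>k, \<cdot>\<rangle> = 0\<close> belongs to the polygon: its predecessor is beyond the
  line of some \<open>t\<^sub>k\<close>, so it lies in the triangle with vertices \<open>0\<close>, \<open>e\<close> and \<open>p = \<plusminus>\<close> the reduced vector of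
  \<open>t\<^sub>k\<close>. Indeed, \<open>p = c\<cdot>e + h\<cdot>f\<close> with \<open>h > 0\<close> gives \<open>N\<cdot>e + f = p / h + ((h\<cdot>N - c) / h)\<cdot>e\<close>, where
  \<open>h\<cdot>(N - 1) < c \<le> h\<cdot>N\<close>. There is one such line on each side of the line of \<open>e\<close>; the orientation \<open>\<delta>\<close> of the
  basis tells them apart.\<close>

lemma first_point_of_adjacent_line:
  assumes e: "reduced_gale_point G i = (of_int e1, of_int e2)" "i < dim_row G"
    and \<delta>: "e1 * f2 - e2 * f1 = \<delta>" "\<delta> = 1 \<or> \<delta> = - 1"
    and k0: "k0 < dim_row G" "row_value G k0 e1 e2 \<noteq> 0"
  obtains N where
    "\<forall>k<dim_row G. 0 \<le> row_value G k e1 e2 * row_value G k (N * e1 + f1) (N * e2 + f2)"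
    "(of_int (N * e1 + f1), of_int (N * e2 + f2)) \<in> gale_polygon G"
proof -
  define \<alpha> \<beta> where "\<alpha> k = row_value G k e1 e2" and "\<beta> k = row_value G k f1 f2" for k
  have lin: "row_value G k (N * e1 + f1) (N * e2 + f2) = N * \<alpha> k + \<beta> k" for k N
    using row_value_combination[of G k N e1 1 f1 e2 f2] by (simp add: \<alpha>_def \<beta>_def)
  define Q where "Q N \<longleftrightarrow> (\<forall>k<dim_row G. 0 \<le> \<alpha> k * (N * \<alpha> k + \<beta> k))" for N
  have bound: "\<bar>\<alpha> k * \<beta> k\<bar> \<le> \<alpha> k * \<alpha> k * \<bar>\<beta> k\<bar>" for k
  proof -
    have "\<bar>\<alpha> k\<bar> \<le> \<bar>\<alpha> k\<bar> * \<bar>\<alpha> k\<bar>"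
      using mult_left_mono[of 1 "\<bar>\<alpha> k\<bar>" "\<bar>\<alpha> k\<bar>"] by (cases "\<alpha> k = 0") simp_all
    then have "\<bar>\<alpha> k\<bar> * \<bar>\<beta> k\<bar> \<le> (\<bar>\<alpha> k\<bar> * \<bar>\<alpha> k\<bar>) * \<bar>\<beta> k\<bar>" by (rule mult_right_mono) simp
    then show ?thesis by (simp add: abs_mult)
  qed
  \<comment> \<open>A parameter that is large enough for all rows, and one that is too small for the row \<open>k0\<close>.\<close>
  define L where "L = (\<Sum>k<dim_row G. \<bar>\<beta> k\<bar>)"
  have "Q L"
    unfolding Q_def
  proof (intro allI impI)
    fix k assume "k < dim_row G"
    then have "\<bar>\<beta> k\<bar> \<le> L" unfolding L_def by (intro member_le_sum) auto
    then have "\<alpha> k * \<alpha> k * \<bar>\<beta> k\<bar> \<le> \<alpha> k * \<alpha> k * L" by (intro mult_left_mono) auto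
    then show "0 \<le> \<alpha> k * (L * \<alpha> k + \<beta> k)" using bound[of k] by (simp add: algebra_simps)
  qed
  define l where "l = - \<bar>\<beta> k0\<bar> - 1"
  have "\<not> Q l"
  proof
    assume "Q l"
    then have "0 \<le> \<alpha> k0 * (l * \<alpha> k0 + \<beta> k0)" using k0(1) by (simp add: Q_def)
    moreover have "\<alpha> k0 * (l * \<alpha> k0 + \<beta> k0) = \<alpha> k0 * \<beta> k0 - \<alpha> k0 * \<alpha> k0 * \<bar>\<beta> k0\<bar> - \<alpha> k0 * \<alpha> k0"
      by (simp add: l_def algebra_simps)
    moreover have "\<alpha> k0 * \<alpha> k0 > 0" using k0(2) by (simp add: \<alpha>_def zero_less_mult_iff linorder_neq_iff disj_commute)
    ultimately show False using bound[of k0] by linarith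
  qed
  have "L \<ge> 0" by (simp add: L_def sum_nonneg)
  then have "l \<le> L" by (simp add: l_def)
  then have ex: "Q (l + int (nat (L - l)))" using \<open>Q L\<close> by simp
  define j where "j = (LEAST j. Q (l + int j))"
  have Qj: "Q (l + int j)" unfolding j_def by (rule LeastI[of "\<lambda>j. Q (l + int j)", OF ex])
  have "j \<noteq> 0" using Qj \<open>\<not> Q l\<close> by (metis add.right_neutral of_nat_0)
  define N where "N = l + int j"
  have QN: "Q N" using Qj by (simp add: N_def)
  have "\<not> Q (l + int (j - 1))"
    using not_less_Least[of "j - 1" "\<lambda>j. Q (l + int j)"] \<open>j \<noteq> 0\<close> unfolding j_def by simp
  moreover have "l + int (j - 1) = N - 1" using \<open>j \<noteq> 0\<close> by (simp add: N_def)
  ultimately obtain k where k: "k < dim_row G" "\<alpha> k * ((N - 1) * \<alpha> k + \<beta> k) < 0"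
    unfolding Q_def by (auto simp: not_le)
  have \<alpha>k: "\<alpha> k \<noteq> 0" using k(2) by auto
  then have "G $$ (k, 0) \<noteq> 0 \<or> G $$ (k, 1) \<noteq> 0" by (auto simp: \<alpha>_def row_value_def)
  then obtain g r1 r2 where g: "g > 0" "reduced_gale G k = (r1, r2)"
      "G $$ (k, 0) = g * r2" "G $$ (k, 1) = - g * r1"
    by (rule reduced_gale_row)
  define h c where "h = sgn (\<alpha> k) * (r2 * e1 - r1 * e2)" and "c = - sgn (\<alpha> k) * (r2 * f1 - r1 * f2)"
  have gh: "g * h = \<bar>\<alpha> k\<bar>" and gc: "g * c = - sgn (\<alpha> k) * \<beta> k"
  proof -
    have val: "g * (r2 * e1 - r1 * e2) = \<alpha> k" "g * (r2 * f1 - r1 * f2) = \<beta> k"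
      unfolding \<alpha>_def \<beta>_def row_value_def g(3,4) by (simp_all add: algebra_simps)
    have "g * h = sgn (\<alpha> k) * (g * (r2 * e1 - r1 * e2))" unfolding h_def by (rule mult.left_commute)
    then show "g * h = \<bar>\<alpha> k\<bar>" unfolding val by (simp add: abs_sgn mult.commute)
    have "g * c = - sgn (\<alpha> k) * (g * (r2 * f1 - r1 * f2))" unfolding c_def by (rule mult.left_commute)
    then show "g * c = - sgn (\<alpha> k) * \<beta> k" unfolding val .
  qed
  have h: "h > 0"
  proof -
    have "0 < g * h" using \<alpha>k by (simp add: gh)
    then show ?thesis using g(1) by (simp add: zero_less_mult_iff)
  qed
  have scaled: "\<alpha> k * (M * \<alpha> k + \<beta> k) = \<bar>\<alpha> k\<bar> * g * (h * M - c)" for M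
  proof -
    have "\<bar>\<alpha> k\<bar> * g * (h * M - c) = \<bar>\<alpha> k\<bar> * ((g * h) * M - g * c)" by (simp add: algebra_simps)
    also have "\<dots> = \<bar>\<alpha> k\<bar> * \<bar>\<alpha> k\<bar> * M + (sgn (\<alpha> k) * \<bar>\<alpha> k\<bar>) * \<beta> k"
      unfolding gh gc by (simp only: algebra_simps minus_mult_left[symmetric] minus_minus)
    also have "\<dots> = \<alpha> k * (M * \<alpha> k + \<beta> k)"
      unfolding sgn_mult_abs by (simp add: algebra_simps)
    finally show ?thesis by simp
  qed
  have "h * (N - 1) - c < 0" using k(2) \<alpha>k g(1) unfolding scaled by (simp add: mult_less_0_iff)
  moreover have "h * N - c \<ge> 0"
  proof -
    have "0 \<le> \<bar>\<alpha> k\<bar> * g * (h * N - c)" using QN k(1) unfolding Q_def scaled[symmetric] by blast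
    moreover have "\<bar>\<alpha> k\<bar> * g > 0" using \<alpha>k g(1) by simp
    ultimately show ?thesis using mult_le_cancel_left_pos[of "\<bar>\<alpha> k\<bar> * g" 0 "h * N - c"] by simp
  qed
  ultimately have gap: "0 \<le> h * N - c" "h * N - c + 1 \<le> h" by (auto simp: algebra_simps)
  define p where "p = (of_int (sgn (\<alpha> k) * \<delta>) :: real) *\<^sub>R reduced_gale_point G k"
  have "sgn (\<alpha> k) * \<delta> = 1 \<or> sgn (\<alpha> k) * \<delta> = - 1" using \<alpha>k \<delta>(2) by (auto simp: sgn_if)
  then have "p = reduced_gale_point G k \<or> p = - reduced_gale_point G k"
    unfolding p_def by (auto simp del: of_int_mult)
  then have pP: "p \<in> gale_polygon G"
    using reduced_point_in_polygon[OF k(1)] by auto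
  \<comment> \<open>Cramer's rule for the expansion of the reduced vector in the basis \<open>e\<close>, \<open>f\<close>.\<close>
  have cramer: "\<delta> * r1 = (r2 * e1 - r1 * e2) * f1 - (r2 * f1 - r1 * f2) * e1"
    "\<delta> * r2 = (r2 * e1 - r1 * e2) * f2 - (r2 * f1 - r1 * f2) * e2"
    by (simp_all add: \<delta>(1)[symmetric] algebra_simps)
  have pe: "sgn (\<alpha> k) * \<delta> * r1 = c * e1 + h * f1" "sgn (\<alpha> k) * \<delta> * r2 = c * e2 + h * f2"
    unfolding c_def h_def mult.assoc[of _ \<delta>] cramer by (simp_all add: algebra_simps)
  have p: "p = (of_int (c * e1 + h * f1), of_int (c * e2 + h * f2))"
    unfolding pe[symmetric] by (simp add: p_def reduced_gale_point_def g(2))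
  let ?X = "(of_int (N * e1 + f1), of_int (N * e2 + f2)) :: real \<times> real"
  have "?X = (1 / of_int h) *\<^sub>R p + (of_int (h * N - c) / of_int h) *\<^sub>R reduced_gale_point G i"
    using h unfolding p e(1) by (simp add: field_simps)
  also have "\<dots> \<in> gale_polygon G"
  proof (rule convex_zero_combination)
    have "real_of_int (h * N - c + 1) \<le> real_of_int h" using gap(2) by (simp only: of_int_le_iff)
    then have "(1 + real_of_int (h * N - c)) / of_int h \<le> 1" using h by (simp add: field_simps)
    then show "1 / real_of_int h + of_int (h * N - c) / of_int h \<le> 1" by (simp only: add_divide_distrib)
    have "real_of_int (h * N - c) \<ge> 0" using gap(1) by (simp only: of_int_0_le_iff)
    then show "0 \<le> real_of_int (h * N - c) / of_int h" using h by simp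
  qed (use h pP e(2) in \<open>auto intro: gale_polygon_convex zero_in_polygon reduced_point_in_polygon\<close>)
  finally have "?X \<in> gale_polygon G" .
  moreover have "\<forall>k<dim_row G. 0 \<le> row_value G k e1 e2 * row_value G k (N * e1 + f1) (N * e2 + f2)"
    using QN unfolding Q_def lin \<alpha>_def .
  ultimately show thesis using that by blast
qed

section \<open>Vertices of the Gale polygon\<close>

text \<open>The polygon is symmetric and not a point, so its centre, the reduced vector of a zero row, is not a
  vertex.\<close>

lemma extreme_row_nonzero:
  assumes gale: "gale_transform T G" "dim_col G = 2"
    and ext: "reduced_gale_point G i extreme_point_of gale_polygon G"
  shows "G $$ (i, 0) \<noteq> 0 \<or> G $$ (i, 1) \<noteq> 0"
proof (rule ccontr)
  assume zero: "\<not> ?thesis"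
  then have i0: "reduced_gale_point G i = 0"
    by (simp add: reduced_gale_point_def reduced_gale_def Let_def zero_prod_def)
  have "\<exists>k<dim_row G. G $$ (k, 0) \<noteq> 0"
  proof (rule ccontr)
    assume "\<not> ?thesis"
    then have zero: "G $$ (k, 0) = 0" if "k < dim_row G" for k using that by blast
    have "G *\<^sub>v plane_vec 1 0 = G *\<^sub>v plane_vec 0 0"
    proof (intro eq_vecI)
      fix k assume "k < dim_vec (G *\<^sub>v plane_vec 0 0)"
      then have k: "k < dim_row G" by simp
      show "(G *\<^sub>v plane_vec 1 0) $ k = (G *\<^sub>v plane_vec 0 0) $ k"
        unfolding mult_plane_vec_index[OF gale(2) k] by (simp add: row_value_def zero[OF k])
    qed simp
    then have "plane_vec 1 0 = plane_vec 0 0"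
      using gale_inj[OF gale(1)] gale(2) plane_vec_carrier by metis
    then have "plane_vec 1 0 $ 0 = plane_vec 0 0 $ 0" by simp
    then show False by (simp add: plane_vec_def)
  qed
  then obtain k where k: "k < dim_row G" "G $$ (k, 0) \<noteq> 0" by blast
  then obtain g r1 r2 where "reduced_gale G k = (r1, r2)" "coprime r1 r2"
    using reduced_gale_row[of G k] by metis
  then have "reduced_gale_point G k \<noteq> 0"
    by (auto simp: reduced_gale_point_def zero_prod_def)
  then have "reduced_gale_point G k \<noteq> - reduced_gale_point G k"
    by (auto simp: prod_eq_iff zero_prod_def)
  then have "midpoint (reduced_gale_point G k) (- reduced_gale_point G k)
      \<in> open_segment (reduced_gale_point G k) (- reduced_gale_point G k)"
    by (simp add: midpoint_in_open_segment)
  then have "0 \<in> open_segment (reduced_gale_point G k) (- reduced_gale_point G k)"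
    by (simp add: midpoint_def)
  then show False
    using ext i0 reduced_point_in_polygon[OF k(1)] unfolding extreme_point_of_def by auto
qed

text \<open>Let the reduced vector \<open>e\<close> of \<open>t\<^sub>i\<close> be a vertex and \<open>X = N\<cdot>e + f\<close>, \<open>Y = N'\<cdot>e - f\<close> be the first lattice points
  of the two lines adjacent to the line of \<open>e\<close>. Both lie in the polygon and \<open>X + Y = (N + N')\<cdot>e\<close>. A sum
  \<open>N + N' \<ge> 2\<close> would make \<open>e\<close> a proper convex combination of \<open>0\<close>, \<open>X\<close> and \<open>Y\<close>; a sum \<open>\<le> 0\<close> would make \<open>X\<close>
  orthogonal to all rows but \<open>t\<^sub>i\<close>, against positivity. So \<open>e = X + Y\<close>, and this sum is conformal at all
  coordinates except \<open>i\<close>. The element belonging to \<open>e\<close> is a Graver element, because one conformally below it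
  vanishes at \<open>i\<close> too and is therefore an integer multiple \<open>c\<cdot>e\<close>, and conformality means \<open>0 \<le> c \<le> 1\<close>.\<close>

lemma extreme_point_splits:
  assumes pg: "positively_graded T" and simple: "simple_toric T"
    and gale: "gale_transform T G" "dim_col G = 2" and i: "i < dim_col T"
    and ext: "reduced_gale_point G i extreme_point_of gale_polygon G"
  obtains u where "u \<in> graver TYPE('k::field) T" "splits {i} T u"
proof -
  let ?n = "dim_col T"
  note rows = gale_dim_row[OF gale(1)]
  obtain g e1 e2 where g: "g > 0" "reduced_gale G i = (e1, e2)" "coprime e1 e2"
      "G $$ (i, 0) = g * e2" "G $$ (i, 1) = - g * e1"
    using reduced_gale_row[OF extreme_row_nonzero[OF gale ext]] by metis
  have e: "reduced_gale_point G i = (of_int e1, of_int e2)"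
    by (simp add: reduced_gale_point_def g(2))
  obtain p q where "p * e1 + q * e2 = 1" using g(3) bezout_int[of e1 e2] by auto
  then obtain f1 f2 where det: "e1 * f2 - e2 * f1 = 1"
    using that[of "- q" p] by (metis (no_types) add.commute diff_minus_eq_add minus_mult_right mult.commute)
  define \<alpha> \<beta> where "\<alpha> k = row_value G k e1 e2" and "\<beta> k = row_value G k f1 f2" for k
  have coords: "x = (x * f2 - y * f1) * e1 + (e1 * y - e2 * x) * f1"
      "y = (x * f2 - y * f1) * e2 + (e1 * y - e2 * x) * f2" for x y
  proof -
    have "(x * f2 - y * f1) * e1 + (e1 * y - e2 * x) * f1 = x * (e1 * f2 - e2 * f1)"
      "(x * f2 - y * f1) * e2 + (e1 * y - e2 * x) * f2 = y * (e1 * f2 - e2 * f1)"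
      by (simp_all add: algebra_simps)
    then show "x = (x * f2 - y * f1) * e1 + (e1 * y - e2 * x) * f1"
      "y = (x * f2 - y * f1) * e2 + (e1 * y - e2 * x) * f2" by (simp_all add: det)
  qed
  have expand: "row_value G k x y = (x * f2 - y * f1) * \<alpha> k + (e1 * y - e2 * x) * \<beta> k" for k x y
    using row_value_combination[of G k "x * f2 - y * f1" e1 "e1 * y - e2 * x" f1 e2 f2]
    unfolding coords(1)[of x y, symmetric] coords(2)[of y x, symmetric] \<alpha>_def \<beta>_def .
  have entry: "(G *\<^sub>v plane_vec x y) $ k = row_value G k x y" if "k < ?n" for k x y
    using mult_plane_vec_index[OF gale(2)] that rows by simp
  have ker: "G *\<^sub>v plane_vec x y \<in> mat_kernel T" for x y
    using gale_in_kernel[OF gale(1)] plane_vec_carrier gale(2) by simp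
  have ker_cases: "\<exists>x y. u = G *\<^sub>v plane_vec x y" if u: "u \<in> mat_kernel T" for u
  proof -
    obtain x where x: "x \<in> carrier_vec 2" "u = G *\<^sub>v x"
      using gale_surj[OF gale(1) u] gale(2) by metis
    then show ?thesis using carrier_vec_2_eq[OF x(1)] by metis
  qed
  have \<alpha>i: "\<alpha> i = 0" unfolding \<alpha>_def row_value_def g(4,5) by simp
  have "\<beta> i = - g * (e1 * f2 - e2 * f1)" unfolding \<beta>_def row_value_def g(4,5) by (simp add: algebra_simps)
  then have \<beta>i: "\<beta> i \<noteq> 0" using g(1) det by simp
  \<comment> \<open>Simplicity: a second row orthogonal to \<open>e\<close> would be parallel to \<open>t\<^sub>i\<close>.\<close>
  have \<beta>0: "\<beta> k = 0" if k: "k < ?n" "k \<noteq> i" "\<alpha> k = 0" for k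
  proof (rule ccontr)
    assume "\<beta> k \<noteq> 0"
    have ratio: "u $ i * \<beta> k = u $ k * \<beta> i" if uker: "u \<in> mat_kernel T" for u
    proof -
      obtain x y where u: "u = G *\<^sub>v plane_vec x y" using ker_cases[OF uker] by blast
      show ?thesis unfolding u entry[OF i] entry[OF k(1)] expand \<alpha>i k(3) by simp
    qed
    have "proportional_coords T i k"
      unfolding proportional_coords_def
    proof (intro exI[of _ "of_int (\<beta> i) / of_int (\<beta> k)"] ballI)
      fix u assume "u \<in> mat_kernel T"
      then have "rat_of_int (u $ i * \<beta> k) = rat_of_int (u $ k * \<beta> i)" using ratio by simp
      then show "rat_of_int (u $ i) = rat_of_int (\<beta> i) / rat_of_int (\<beta> k) * rat_of_int (u $ k)"
        using \<open>\<beta> k \<noteq> 0\<close> by (simp add: field_simps)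
    qed
    moreover have "proportional_coords T k i"
      unfolding proportional_coords_def
    proof (intro exI[of _ "of_int (\<beta> k) / of_int (\<beta> i)"] ballI)
      fix u assume "u \<in> mat_kernel T"
      then have "rat_of_int (u $ i * \<beta> k) = rat_of_int (u $ k * \<beta> i)" using ratio by simp
      then show "rat_of_int (u $ k) = rat_of_int (\<beta> k) / rat_of_int (\<beta> i) * rat_of_int (u $ i)"
        using \<beta>i by (simp add: field_simps)
    qed
    ultimately have "(i, k) \<in> bouquet_edges G"
      using bouquet_edges_iff[OF gale(1)] i k by simp
    then show False using simple_toric_no_edges[OF simple gale(1)] by simp
  qed
  define u where "u = G *\<^sub>v plane_vec e1 e2"
  have uk: "u $ k = \<alpha> k" if "k < ?n" for k using entry[OF that] by (simp add: u_def \<alpha>_def)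
  have u0: "u \<noteq> 0\<^sub>v ?n"
  proof
    assume "u = 0\<^sub>v ?n"
    moreover have "G *\<^sub>v plane_vec 0 0 = 0\<^sub>v ?n"
      using entry rows by (intro eq_vecI) (auto simp: row_value_def)
    ultimately have "plane_vec e1 e2 = plane_vec 0 0"
      using gale_inj[OF gale(1)] plane_vec_carrier gale(2) by (metis u_def)
    then have "plane_vec e1 e2 $ 0 = plane_vec 0 0 $ 0" "plane_vec e1 e2 $ 1 = plane_vec 0 0 $ 1" by simp_all
    then show False using det by (simp add: plane_vec_def)
  qed
  obtain k0 where k0: "k0 < ?n" "\<alpha> k0 \<noteq> 0"
    using u0 uk dim_kernel[OF ker, of e1 e2] unfolding u_def[symmetric]
    by (metis eq_vecI index_zero_vec)
  have u_graver: "u \<in> graver TYPE('k) T"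
    unfolding graver_iff
  proof (intro conjI ballI impI)
    show "u \<in> mat_kernel T" unfolding u_def by (rule ker)
    show "u \<noteq> 0\<^sub>v ?n" by (rule u0)
    fix v assume v: "v \<in> mat_kernel T" "v \<noteq> 0\<^sub>v ?n" and below: "conformally_below v u"
    have bd: "nat (v $ k) \<le> nat (\<alpha> k)" "nat (- v $ k) \<le> nat (- \<alpha> k)" if "k < ?n" for k
      using below that uk[OF that] dim_kernel[OF ker, of e1 e2] unfolding u_def[symmetric]
      by (auto simp: conformally_below_def)
    obtain x y where xy: "v = G *\<^sub>v plane_vec x y" using ker_cases[OF v(1)] by blast
    define c d where "c = x * f2 - y * f1" and "d = e1 * y - e2 * x"
    have vk: "v $ k = c * \<alpha> k + d * \<beta> k" if "k < ?n" for k
      using entry[OF that] expand by (simp add: xy c_def d_def)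
    have "v $ i = 0" using bd[OF i] \<alpha>i by simp
    then have d: "d = 0" using vk[OF i] \<alpha>i \<beta>i by simp
    have c: "c = 0 \<or> c = 1"
    proof -
      have cle: "nat (c * \<alpha> k0) \<le> nat (\<alpha> k0)" "nat (- (c * \<alpha> k0)) \<le> nat (- \<alpha> k0)"
        using bd[OF k0(1)] vk[OF k0(1)] d by simp_all
      have between: "0 \<le> y \<and> y \<le> z \<or> z \<le> y \<and> y \<le> 0"
        if "nat y \<le> nat z" "nat (- y) \<le> nat (- z)" for y z :: int
        using that by linarith
      have "0 * \<alpha> k0 \<le> c * \<alpha> k0 \<and> c * \<alpha> k0 \<le> 1 * \<alpha> k0 \<or>
          1 * \<alpha> k0 \<le> c * \<alpha> k0 \<and> c * \<alpha> k0 \<le> 0 * \<alpha> k0"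
        using between[OF cle] unfolding mult_zero_left mult_1_left .
      then have "0 \<le> c \<and> c \<le> 1"
        unfolding mult_le_cancel_right using k0(2) by auto
      then show ?thesis by linarith
    qed
    have "c \<noteq> 0"
    proof
      assume "c = 0"
      then have "v = 0\<^sub>v ?n" using vk d dim_kernel[OF v(1)] by (intro eq_vecI) auto
      then show False using v(2) by simp
    qed
    then show "v = u"
      using c d vk uk dim_kernel[OF v(1)] dim_kernel[OF ker, of e1 e2] unfolding u_def[symmetric]
      by (intro eq_vecI) auto
  qed
  have k0': "k0 < dim_row G" "row_value G k0 e1 e2 \<noteq> 0" using k0 rows by (simp_all add: \<alpha>_def)
  have i': "i < dim_row G" using i rows by simp
  obtain N where N: "\<forall>k<dim_row G. 0 \<le> row_value G k e1 e2 * row_value G k (N * e1 + f1) (N * e2 + f2)"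
      "(of_int (N * e1 + f1), of_int (N * e2 + f2)) \<in> gale_polygon G"
    using first_point_of_adjacent_line[OF e i' det _ k0'] by blast
  have det': "e1 * (- f2) - e2 * (- f1) = - 1" using det by (simp add: algebra_simps)
  obtain N' where N': "\<forall>k<dim_row G. 0 \<le> row_value G k e1 e2 * row_value G k (N' * e1 + - f1) (N' * e2 + - f2)"
      "(of_int (N' * e1 + - f1), of_int (N' * e2 + - f2)) \<in> gale_polygon G"
    using first_point_of_adjacent_line[OF e i' det' _ k0'] by blast
  have lin: "row_value G k (N * e1 + f1) (N * e2 + f2) = N * \<alpha> k + \<beta> k"
      "row_value G k (N' * e1 + - f1) (N' * e2 + - f2) = N' * \<alpha> k - \<beta> k" for k
    by (simp_all add: \<alpha>_def \<beta>_def row_value_def algebra_simps)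
  have sides: "0 \<le> \<alpha> k * (N * \<alpha> k + \<beta> k)" "0 \<le> \<alpha> k * (N' * \<alpha> k - \<beta> k)" if "k < ?n" for k
    using N(1) N'(1) that rows unfolding lin \<alpha>_def[symmetric] by simp_all
  have "N + N' < 2"
  proof (rule ccontr)
    assume "\<not> N + N' < 2"
    then have m: "N + N' \<ge> 2" by simp
    define X Y :: "real \<times> real" where "X = (of_int (N * e1 + f1), of_int (N * e2 + f2))"
      and "Y = (of_int (N' * e1 + - f1), of_int (N' * e2 + - f2))"
    define t :: real where "t = 2 / of_int (N + N')"
    have mr: "real_of_int (N + N') \<ge> 2" using m by linarith
    then have t: "0 < t" "t \<le> 1" by (simp_all add: t_def)
    have P: "t *\<^sub>R X \<in> gale_polygon G" "t *\<^sub>R Y \<in> gale_polygon G"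
      using convex_zero_combination[OF gale_polygon_convex zero_in_polygon[OF i'] N(2) N(2), of t 0]
        convex_zero_combination[OF gale_polygon_convex zero_in_polygon[OF i'] N'(2) N'(2), of t 0] t
      by (simp_all add: X_def Y_def)
    have "X \<noteq> Y"
    proof
      assume "X = Y"
      then have eq: "N * e1 + f1 = N' * e1 + - f1" "N * e2 + f2 = N' * e2 + - f2"
        unfolding X_def Y_def by (simp_all only: prod.inject of_int_eq_iff)
      have "e1 * (N * e2 + f2) - e2 * (N * e1 + f1) = 1"
        "e1 * (N' * e2 + - f2) - e2 * (N' * e1 + - f1) = - 1"
        using det by (simp_all add: algebra_simps)
      then show False unfolding eq by simp
    qed
    then have "t *\<^sub>R X \<noteq> t *\<^sub>R Y" using t(1) by simp
    then have "midpoint (t *\<^sub>R X) (t *\<^sub>R Y) \<in> open_segment (t *\<^sub>R X) (t *\<^sub>R Y)"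
      by (simp add: midpoint_in_open_segment)
    moreover have "midpoint (t *\<^sub>R X) (t *\<^sub>R Y) = reduced_gale_point G i"
    proof -
      have "X + Y = of_int (N + N') *\<^sub>R reduced_gale_point G i"
        by (simp add: X_def Y_def e algebra_simps)
      then have "midpoint (t *\<^sub>R X) (t *\<^sub>R Y) = (t / 2 * of_int (N + N')) *\<^sub>R reduced_gale_point G i"
        by (simp add: midpoint_def scaleR_add_right[symmetric])
      also have "t / 2 * of_int (N + N') = 1" using mr by (simp add: t_def)
      finally show ?thesis by simp
    qed
    ultimately show False using ext P unfolding extreme_point_of_def by auto
  qed
  moreover have "N + N' > 0"
  proof (rule ccontr)
    assume "\<not> N + N' > 0"
    have only_i: "N * \<alpha> k + \<beta> k = 0" if k: "k < ?n" "k \<noteq> i" for k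
    proof (cases "\<alpha> k = 0")
      case True
      then show ?thesis using \<beta>0[OF k] by simp
    next
      case False
      have "\<alpha> k * (N * \<alpha> k + \<beta> k) + \<alpha> k * (N' * \<alpha> k - \<beta> k) = (N + N') * (\<alpha> k * \<alpha> k)"
        by (simp add: algebra_simps)
      moreover have "(N + N') * (\<alpha> k * \<alpha> k) \<le> 0"
        using \<open>\<not> N + N' > 0\<close> by (intro mult_nonpos_nonneg) auto
      ultimately have "\<alpha> k * (N * \<alpha> k + \<beta> k) = 0" using sides[OF k(1)] by linarith
      then show ?thesis using False by simp
    qed
    define z where "z = G *\<^sub>v plane_vec (sgn (\<beta> i) * (N * e1 + f1)) (sgn (\<beta> i) * (N * e2 + f2))"
    have zk: "z $ k = sgn (\<beta> i) * (N * \<alpha> k + \<beta> k)" if "k < ?n" for k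
      unfolding z_def entry[OF that] lin(1)[symmetric] by (simp add: row_value_def algebra_simps)
    have zi: "z $ i = \<bar>\<beta> i\<bar>" using zk[OF i] \<alpha>i by (simp add: abs_sgn mult.commute)
    have "\<forall>k<?n. z $ k \<ge> 0"
    proof (intro allI impI)
      fix k assume "k < ?n"
      then show "z $ k \<ge> 0" using zi zk only_i by (cases "k = i") auto
    qed
    then have "z = 0\<^sub>v ?n"
      using nonneg_kernel_element_eq_zero[OF pg] ker unfolding z_def by blast
    then show False using zi \<beta>i i by simp
  qed
  ultimately have one: "N + N' = 1" by linarith
  define v w where "v = G *\<^sub>v plane_vec (N * e1 + f1) (N * e2 + f2)"
    and "w = G *\<^sub>v plane_vec (N' * e1 + - f1) (N' * e2 + - f2)"
  have vk: "v $ k = N * \<alpha> k + \<beta> k" and wk: "w $ k = N' * \<alpha> k - \<beta> k" if "k < ?n" for k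
    unfolding v_def w_def entry[OF that] lin by simp_all
  have vw: "v \<in> mat_kernel T" "w \<in> mat_kernel T" unfolding v_def w_def by (rule ker)+
  have nz: "v \<noteq> 0\<^sub>v ?n" "w \<noteq> 0\<^sub>v ?n" using vk[OF i] wk[OF i] \<alpha>i \<beta>i i by auto
  have uvw: "u = v + w"
  proof (intro eq_vecI)
    fix k assume "k < dim_vec (v + w)"
    then have k: "k < ?n" using dim_kernel[OF vw(2)] by simp
    have "\<alpha> k = (N + N') * \<alpha> k" by (simp add: one)
    then show "u $ k = (v + w) $ k"
      using k uk[OF k] vk[OF k] wk[OF k] dim_kernel[OF vw(2)] by (simp add: algebra_simps)
  qed (use dim_kernel[OF ker, of e1 e2] dim_kernel[OF vw(2)] in \<open>simp add: u_def\<close>)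
  have conf: "\<not> (v $ k > 0 \<and> w $ k < 0) \<and> \<not> (v $ k < 0 \<and> w $ k > 0)" if k: "k < ?n" "k \<noteq> i" for k
  proof (cases "\<alpha> k = 0")
    case True
    then show ?thesis using vk[OF k(1)] \<beta>0[OF k True] by simp
  next
    case False
    then show ?thesis using sides[OF k(1)] vk[OF k(1)] wk[OF k(1)]
      by (auto simp: zero_le_mult_iff)
  qed
  have "splits {i} T u"
  proof (cases "\<beta> i < 0")
    case True
    then have "\<not> (v $ k > 0 \<and> w $ k < 0) \<and> (k \<notin> {i} \<longrightarrow> \<not> (v $ k < 0 \<and> w $ k > 0))" if "k < ?n" for k
      using conf[OF that] vk[OF i] \<alpha>i by (cases "k = i") auto
    then show ?thesis unfolding splits_def using vw nz uvw by blast
  next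
    case False
    then have "\<not> (w $ k > 0 \<and> v $ k < 0) \<and> (k \<notin> {i} \<longrightarrow> \<not> (w $ k < 0 \<and> v $ k > 0))" if "k < ?n" for k
      using conf[OF that] wk[OF i] \<alpha>i \<beta>i by (cases "k = i") auto
    moreover have "u = w + v"
      unfolding uvw by (rule comm_add_vec[OF vw[THEN mat_kernel_carrier_vec]])
    ultimately show ?thesis unfolding splits_def using vw nz by blast
  qed
  then show thesis using that u_graver by blast
qed

theorem theorem4p2:
  fixes T G :: "int mat"
  assumes "positively_graded T"
    and "simple_toric T"
    and "codimension T = 2"
    and "gale_transform T G"
  shows "abstract_simplicial_complex (robustness_complex TYPE('k::field) T) \<and>
    robustness_complex TYPE('k) T \<subseteq>
      Pow {i. i < dim_col T \<and> \<not> reduced_gale_point G i extreme_point_of gale_polygon G}"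
proof (intro conjI subsetI PowI)
  show "abstract_simplicial_complex (robustness_complex TYPE('k) T)"
    by (rule robustness_complex_simplicial[OF assms(1,2,4)])
  fix \<omega> i assume \<omega>: "\<omega> \<in> robustness_complex TYPE('k) T" and i: "i \<in> \<omega>"
  have col: "dim_col G = 2" using codimension_eq[OF assms(4)] assms(3) by simp
  have iT: "i < dim_col T" and S: "S_omega TYPE('k) T \<omega> = graver TYPE('k) T"
    using \<omega> i by (auto simp: robustness_complex_def)
  have "\<not> reduced_gale_point G i extreme_point_of gale_polygon G"
  proof
    assume "reduced_gale_point G i extreme_point_of gale_polygon G"
    then obtain u where u: "u \<in> graver TYPE('k) T" "splits {i} T u"
      using extreme_point_splits[OF assms(1,2,4) col iT, where 'k='k] by blast
    then have "splits \<omega> T u" using splits_mono i by blast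
    then show False using u(1) S S_omega_not_splits[of u T \<omega>, where 'k='k] by blast
  qed
  then show "i \<in> {i. i < dim_col T \<and> \<not> reduced_gale_point G i extreme_point_of gale_polygon G}"
    using iT by simp
qed

end
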